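(* Let $L=[L_{j,k}(D_y)]_{m\times m}$ be a system of pseudo-differential operators $L_{j,k}(D_y)\in\Psi^\nu(\mathbb{T}^N)$, $\nu\in\mathbb{R}$, with matrix symbol $L(\eta)=[L_{j,k}(\eta)]_{m\times m}$, and let $\lambda_1(\eta),\dots,\lambda_m(\eta)$ be the eigenvalues of $L(\eta)$, $\eta\in\mathbb{Z}^N$, ordered so that $|\lambda_1(\eta)|\le|\lambda_2(\eta)|\le\dots\le|\lambda_m(\eta)|$. Then $L$ is globally hypoelliptic if and only if there are positive constants $C_j$, $M_j$ and $R_j$ satisfying $$|\lambda_j(\eta)|\ge C_j|\eta|^{-M_j},\quad |\eta|\ge R_j,$$ for $j=1,\dots,m$.
   Context: $\mathbb{T}=\mathbb{R}/2\pi\mathbb{Z}$. $\Psi^\nu(\mathbb{T}^N)$ is the class of operators $a(D_y)u(y)=\sum_{\eta\in\mathbb{Z}^N}e^{iy\cdot\eta}a(\eta)\widehat u(\eta)$, acting on functions and distributions, whose symbol satisfies $|a(\eta)|\le C|\eta|^\nu$ for all $\eta\in\mathbb{Z}^N\setminus\{0\}$, for some $C>0$; here $\widehat u(\eta)=(2\pi)^{-N}\langle u,e^{-iy\cdot\eta}\rangle$. Eigenvalues are listed with multiplicity. $\mathcal{D}'_m(\mathbb{T}^N)$ and $C^\infty_m(\mathbb{T}^N)$ are the spaces of $m$-dimensional vectors with coordinates in $\mathcal{D}'(\mathbb{T}^N)$ and $C^\infty(\mathbb{T}^N)$. $L$ is globally hypoelliptic if $u\in\mathcal{D}'_m(\mathbb{T}^N)$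 and $Lu\in C^\infty_m(\mathbb{T}^N)$ imply $u\in C^\infty_m(\mathbb{T}^N)$. *)

theory Defs
  imports "HOL-Analysis.Analysis" "Jordan_Normal_Form.Char_Poly"
begin

text \<open>
  Functions on the torus of dimension \<open>CARD('n)\<close> are functions on \<open>real ^ 'n\<close> that are
  \<open>2 * pi\<close>-periodic in every coordinate.
  The prefix forms \<open>vec_nth\<close> and \<open>inner\<close> are used because the infix symbols are also claimed
  by the Jordan normal form matrix library.
\<close>

definition partial :: "'n::finite \<Rightarrow> (real ^ 'n \<Rightarrow> complex) \<Rightarrow> real ^ 'n \<Rightarrow> complex" where
  "partial i f = (\<lambda>y. frechet_derivative f (at y) (axis i 1))"

text \<open>The list records the successive directions of differentiation; lists of length at most \<open>k\<close>
  cover all multi-indices of order at most \<open>k\<close>.\<close>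

definition partials :: "'n::finite list \<Rightarrow> (real ^ 'n \<Rightarrow> complex) \<Rightarrow> real ^ 'n \<Rightarrow> complex" where
  "partials is f = fold partial is f"

definition torus_smooth :: "(real ^ 'n::finite \<Rightarrow> complex) set" where
  "torus_smooth = {f. (\<forall>i y. f (y + axis i (2 * pi)) = f y) \<and>
                      (\<forall>is y. partials is f differentiable (at y))}"

text \<open>The seminorms defining the Frechet topology of \<open>torus_smooth\<close>. The supremum is over a bounded
  set for functions in \<open>torus_smooth\<close>, by periodicity.\<close>

definition Ck_norm :: "nat \<Rightarrow> (real ^ 'n::finite \<Rightarrow> complex) \<Rightarrow> real" where
  "Ck_norm k f = Sup {norm (partials is f y) | is y. length is \<le> k}"

text \<open>Distributions are the complex-linear functionals on \<open>torus_smooth\<close> that are continuous for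
  these seminorms. A functional is a total function, but only its values on \<open>torus_smooth\<close>
  are ever constrained or used.\<close>

type_synonym 'n functional = "(real ^ 'n \<Rightarrow> complex) \<Rightarrow> complex"

definition torus_distribution :: "'n::finite functional set" where
  "torus_distribution = {u.
     (\<forall>\<phi>\<in>torus_smooth. \<forall>\<psi>\<in>torus_smooth. u (\<lambda>y. \<phi> y + \<psi> y) = u \<phi> + u \<psi>) \<and>
     (\<forall>c. \<forall>\<phi>\<in>torus_smooth. u (\<lambda>y. c * \<phi> y) = c * u \<phi>) \<and>
     (\<exists>C k. \<forall>\<phi>\<in>torus_smooth. norm (u \<phi>) \<le> C * Ck_norm k \<phi>)}"

definition torus_integral :: "(real ^ 'n::finite \<Rightarrow> complex) \<Rightarrow> complex" where
  "torus_integral f = integral (cbox 0 (\<chi> i. 2 * pi)) f"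

text \<open>\<open>u\<close> belongs to the space of smooth functions if it is integration against one.\<close>

definition is_smooth_distribution :: "'n::finite functional \<Rightarrow> bool" where
  "is_smooth_distribution u \<longleftrightarrow>
     (\<exists>f\<in>torus_smooth. \<forall>\<phi>\<in>torus_smooth. u \<phi> = torus_integral (\<lambda>y. f y * \<phi> y))"

definition freq :: "int ^ 'n::finite \<Rightarrow> real ^ 'n" where
  "freq \<eta> = (\<chi> i. real_of_int (vec_nth \<eta> i))"

definition torus_char :: "int ^ 'n::finite \<Rightarrow> real ^ 'n \<Rightarrow> complex" where
  "torus_char \<eta> y = exp (\<i> * complex_of_real (inner y (freq \<eta>)))"

definition fourier_coeff :: "'n::finite functional \<Rightarrow> int ^ 'n \<Rightarrow> complex" where
  "fourier_coeff u \<eta> = u (torus_char (- \<eta>)) / complex_of_real ((2 * pi) ^ CARD('n))"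

definition symbol_class :: "real \<Rightarrow> (int ^ 'n::finite \<Rightarrow> complex) set" where
  "symbol_class \<nu> = {a. \<exists>C>0. \<forall>\<eta>. \<eta> \<noteq> 0 \<longrightarrow> norm (a \<eta>) \<le> C * norm (freq \<eta>) powr \<nu>}"

text \<open>The series \<open>\<Sum>\<eta>. exp (\<i> y \<cdot> \<eta>) * a \<eta> * fourier_coeff u \<eta>\<close> converges in the sense of distributions;
  its sum is evaluated on a test function by summing the pairings of its terms.\<close>

definition psdo :: "(int ^ 'n::finite \<Rightarrow> complex) \<Rightarrow> 'n functional \<Rightarrow> 'n functional" where
  "psdo a u = (\<lambda>\<phi>. \<Sum>\<^sub>\<infinity>\<eta>. a \<eta> * fourier_coeff u \<eta> * torus_integral (\<lambda>y. torus_char \<eta> y * \<phi> y))"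

text \<open>Systems: components are numbered from \<open>0\<close> to \<open>m - 1\<close>, as are the matrix entries.\<close>

definition psdo_system ::
    "nat \<Rightarrow> (int ^ 'n::finite \<Rightarrow> complex mat) \<Rightarrow> (nat \<Rightarrow> 'n functional) \<Rightarrow> nat \<Rightarrow> 'n functional" where
  "psdo_system m L u j = (\<lambda>\<phi>. \<Sum>k<m. psdo (\<lambda>\<eta>. L \<eta> $$ (j, k)) (u k) \<phi>)"

definition globally_hypoelliptic :: "nat \<Rightarrow> (int ^ 'n::finite \<Rightarrow> complex mat) \<Rightarrow> bool" where
  "globally_hypoelliptic m L \<longleftrightarrow>
     (\<forall>u. (\<forall>j<m. u j \<in> torus_distribution) \<and>
          (\<forall>j<m. is_smooth_distribution (psdo_system m L u j)) \<longrightarrow>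
          (\<forall>j<m. is_smooth_distribution (u j)))"

end

theory Submission
  imports Defs
begin

text \<open>
  A distribution on the torus is smooth iff its Fourier coefficients decay faster than every power of
  the frequency, and \<open>L\<close> acts on the vector of Fourier coefficients at \<open>\<eta>\<close> as the matrix \<open>L(\<eta>)\<close>.
  If all eigenvalues are bounded below by a power of \<open>|\<eta>|\<close>, so is \<open>|det L(\<eta>)|\<close>, and Cramer's rule
  recovers the coefficients of \<open>u\<close> from those of \<open>Lu\<close> at the cost of a polynomial factor.
  If not, then \<open>\<lambda>\<^sub>1\<close> is smaller than every power along a sequence of frequencies; normalized eigenvectors
  at these frequencies are the coefficients of a non-smooth \<open>u\<close> for which \<open>Lu\<close> is smooth.
\<close>

section \<open>Rapidly decreasing and slowly increasing coefficients\<close>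

text \<open>The delicate half of the dictionary is that a distribution is determined by its
  coefficients. This requires each test function to be the sum of its Fourier series in every
  \<open>Ck_norm\<close>, hence that a continuous periodic function with vanishing coefficients is
  zero. Cramer's rule is used because eigenvalues alone do not control the inverse of a non-normal
  matrix: the entries of the symbol grow at most polynomially, so its cofactors do too, and only the
  determinant needs a lower bound. It can vanish at finitely many frequencies only, which affects
  \<open>u\<close> by a trigonometric polynomial. In the converse, failure of the bound for any
  index passes to the smallest eigenvalue by the ordering. Refuting the constants C = 1 and M = R =
  n + 1 for each n yields the frequencies. The eigenvectors are normalized in the l1 norm, so the
  coefficients stay bounded while their components cannot all decay.\<close>

definition weight :: "int ^ 'n::finite \<Rightarrow> real" where
  "weight \<eta> = 1 + norm (freq \<eta>)"

lemma vec_nth_freq [simp]: "vec_nth (freq \<eta>) i = real_of_int (vec_nth \<eta> i)"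
  by (simp add: freq_def)

lemma freq_add: "freq (\<eta> + \<zeta>) = freq \<eta> + freq \<zeta>"
  and freq_minus: "freq (- \<eta>) = - freq \<eta>"
  and freq_zero [simp]: "freq 0 = 0"
  by (simp_all add: Finite_Cartesian_Product.vec_eq_iff)

text \<open>This is what the summand 1 in \<open>weight\<close> is for: powers increase with the
  exponent at every frequency, including 0.\<close>

lemma weight_ge_1: "1 \<le> weight \<eta>"
  by (simp add: weight_def)

lemma weight_pos: "0 < weight \<eta>"
  using weight_ge_1[of \<eta>] by linarith

lemma weight_nonneg [simp]: "0 \<le> weight \<eta>"
  by (simp add: weight_def)

lemma weight_uminus [simp]: "weight (- \<eta>) = weight \<eta>"
  by (simp add: weight_def freq_minus)

lemma norm_freq_le_weight: "norm (freq \<eta>) \<le> weight \<eta>"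
  by (simp add: weight_def)

lemma abs_nth_le_weight: "1 + \<bar>real_of_int (vec_nth \<eta> i)\<bar> \<le> weight \<eta>"
  using component_le_norm_cart[of "freq \<eta>" i] by (simp add: weight_def)

section \<open>Finiteness and summability over the frequency lattice\<close>

lemma finite_int_box: "finite {\<eta> :: int ^ 'n::finite. \<forall>i. \<bar>vec_nth \<eta> i\<bar> \<le> c}"
proof -
  have "{\<eta> :: int ^ 'n. \<forall>i. \<bar>vec_nth \<eta> i\<bar> \<le> c} \<subseteq> vec_lambda ` (PiE UNIV (\<lambda>_. {-c..c}))"
  proof
    fix \<eta> :: "int ^ 'n" assume "\<eta> \<in> {\<eta>. \<forall>i. \<bar>vec_nth \<eta> i\<bar> \<le> c}"
    then have "vec_nth \<eta> \<in> PiE UNIV (\<lambda>_. {-c..c})"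
      by (auto simp: abs_le_iff minus_le_iff)
    then show "\<eta> \<in> vec_lambda ` (PiE UNIV (\<lambda>_. {-c..c}))"
      by (metis image_eqI vec_nth_inverse)
  qed
  then show ?thesis
    by (rule finite_subset) (simp add: finite_PiE)
qed

lemma finite_norm_freq_le: "finite {\<eta> :: int ^ 'n::finite. norm (freq \<eta>) \<le> R}"
proof (rule finite_subset[OF _ finite_int_box[of "\<lceil>R\<rceil>"]], clarify)
  fix \<eta> :: "int ^ 'n" and i assume "norm (freq \<eta>) \<le> R"
  then show "\<bar>vec_nth \<eta> i\<bar> \<le> \<lceil>R\<rceil>"
    using component_le_norm_cart[of "freq \<eta>" i] by simp linarith
qed

text \<open>The subtracted term makes the induction close: passing from \<open>c\<close> to
  \<open>c + 1\<close> adds two terms \<open>1 / (2 + c)^2\<close>, which the telescoping difference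
  of \<open>2 / (1 + c)\<close> absorbs.\<close>

lemma sum_inverse_square_int_le:
  "(\<Sum>a\<in>{- int c..int c}. inverse ((1 + \<bar>real_of_int a\<bar>)\<^sup>2)) \<le> 4 - 2 / (1 + real c)"
proof (induction c)
  case 0
  then show ?case by simp
next
  case (Suc c)
  have eq: "{- int (Suc c)..int (Suc c)} = insert (- int (Suc c)) (insert (int (Suc c)) {- int c..int c})"
    by auto
  have "2 * inverse ((2 + real c)\<^sup>2) \<le> 2 / ((1 + real c) * (2 + real c))"
    by (simp add: divide_simps power2_eq_square)
  also have "\<dots> = 2 / (1 + real c) - 2 / (2 + real c)"
    by (simp add: divide_simps)
  finally have "2 * inverse ((2 + real c)\<^sup>2) \<le> 2 / (1 + real c) - 2 / (2 + real c)" .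
  then show ?case using Suc.IH unfolding eq by simp
qed

text \<open>Each factor \<open>1 + |\<eta>_i|\<close> is at most \<open>weight \<eta>\<close>, so
  the exponent \<open>2 * CARD('n)\<close> lets the term be dominated by a product of
  one-dimensional inverse squares; over a box the sum of these products factorizes.\<close>

lemma summable_inverse_weight:
  "(\<lambda>\<eta> :: int ^ 'n::finite. inverse (weight \<eta> ^ (2 * CARD('n)))) summable_on UNIV"
proof (rule nonneg_bdd_above_summable_on)
  show "0 \<le> inverse (weight \<eta> ^ (2 * CARD('n)))" for \<eta> :: "int ^ 'n"
    using weight_pos[of \<eta>] by simp
  show "bdd_above (sum (\<lambda>\<eta> :: int ^ 'n. inverse (weight \<eta> ^ (2 * CARD('n)))) ` {F. F \<subseteq> UNIV \<and> finite F})"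
  proof (rule bdd_aboveI2)
    fix F :: "(int ^ 'n) set" assume "F \<in> {F. F \<subseteq> UNIV \<and> finite F}"
    then have fin: "finite F" by simp
    \<comment> \<open>A crude radius of a box containing \<open>F\<close>; the final bound does not
      depend on it.\<close>
    define c where "c = (\<Sum>\<eta>\<in>F. \<Sum>i\<in>UNIV. nat \<bar>vec_nth \<eta> i\<bar>)"
    let ?B = "PiE (UNIV :: 'n set) (\<lambda>_. {- int c..int c})"
    let ?g = "\<lambda>a. inverse ((1 + \<bar>real_of_int a\<bar>)\<^sup>2)"
    have mem: "vec_nth \<eta> \<in> ?B" if "\<eta> \<in> F" for \<eta>
    proof -
      have "\<bar>vec_nth \<eta> i\<bar> \<le> int c" for i
      proof -
        have "nat \<bar>vec_nth \<eta> i\<bar> \<le> (\<Sum>i\<in>UNIV. nat \<bar>vec_nth \<eta> i\<bar>)"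
          by (rule member_le_sum) auto
        also have "\<dots> \<le> c"
          unfolding c_def by (rule member_le_sum[OF that]) (use fin in auto)
        finally show ?thesis by linarith
      qed
      then show ?thesis by (auto simp: abs_le_iff minus_le_iff)
    qed
    have le: "inverse (weight \<eta> ^ (2 * CARD('n))) \<le> (\<Prod>i\<in>UNIV. ?g (vec_nth \<eta> i))" for \<eta> :: "int ^ 'n"
    proof -
      have "(\<Prod>i\<in>(UNIV::'n set). (1 + \<bar>real_of_int (vec_nth \<eta> i)\<bar>)\<^sup>2) \<le> (\<Prod>i\<in>(UNIV::'n set). (weight \<eta>)\<^sup>2)"
        by (intro prod_mono conjI power_mono abs_nth_le_weight) auto
      also have "\<dots> = weight \<eta> ^ (2 * CARD('n))"
        by (simp add: power_mult)
      finally have "inverse (weight \<eta> ^ (2 * CARD('n))) \<le> inverse (\<Prod>i\<in>(UNIV::'n set). (1 + \<bar>real_of_int (vec_nth \<eta> i)\<bar>)\<^sup>2)"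
        by (intro le_imp_inverse_le prod_pos) (auto intro!: zero_less_power add_pos_nonneg)
      then show ?thesis using prod_inversef[of "\<lambda>i. (1 + \<bar>real_of_int (vec_nth \<eta> i)\<bar>)\<^sup>2" "UNIV :: 'n set"]
        by (simp add: comp_def)
    qed
    have "(\<Sum>\<eta>\<in>F. inverse (weight \<eta> ^ (2 * CARD('n)))) \<le> (\<Sum>\<eta>\<in>F. \<Prod>i\<in>UNIV. ?g (vec_nth \<eta> i))"
      by (intro sum_mono le)
    also have "\<dots> = (\<Sum>h\<in>vec_nth ` F. \<Prod>i\<in>UNIV. ?g (h i))"
      by (subst sum.reindex) (auto simp: inj_on_def vec_nth_inject)
    also have "\<dots> \<le> (\<Sum>h\<in>?B. \<Prod>i\<in>UNIV. ?g (h i))"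
      by (rule sum_mono2) (use mem in \<open>auto intro!: finite_PiE prod_nonneg\<close>)
    also have "\<dots> = (\<Prod>i\<in>(UNIV::'n set). \<Sum>a\<in>{- int c..int c}. ?g a)"
      by (subst prod_sum_PiE) auto
    also have "\<dots> \<le> (\<Prod>i\<in>(UNIV::'n set). 4)"
    proof (intro prod_mono conjI)
      have "(\<Sum>a\<in>{- int c..int c}. ?g a) \<le> 4 - 2 / (1 + real c)"
        by (rule sum_inverse_square_int_le)
      also have "\<dots> \<le> 4" by simp
      finally show "(\<Sum>a\<in>{- int c..int c}. ?g a) \<le> 4" .
    qed (auto intro!: sum_nonneg)
    finally show "(\<Sum>\<eta>\<in>F. inverse (weight \<eta> ^ (2 * CARD('n)))) \<le> 4 ^ CARD('n)"
      by simp
  qed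
qed

section \<open>Characters of the torus\<close>

lemma norm_torus_char [simp]: "norm (torus_char \<eta> y) = 1"
  by (simp add: torus_char_def)

lemma torus_char_zero [simp]: "torus_char 0 y = 1"
  by (simp add: torus_char_def)

lemma torus_char_add: "torus_char (\<eta> + \<zeta>) y = torus_char \<eta> y * torus_char \<zeta> y"
  by (simp add: torus_char_def freq_add exp_add algebra_simps)

lemma torus_char_plus: "torus_char \<eta> (y + z) = torus_char \<eta> y * torus_char \<eta> z"
  by (simp add: torus_char_def exp_add algebra_simps)

lemma torus_char_axis: "torus_char \<eta> (axis i t) = exp (\<i> * complex_of_real (t * real_of_int (vec_nth \<eta> i)))"
  by (simp add: torus_char_def inner_axis' )

lemma torus_char_periodic: "torus_char \<eta> (y + axis i (2 * pi)) = torus_char \<eta> y"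
proof -
  have "torus_char \<eta> (axis i (2 * pi)) = exp ((2 * of_int (vec_nth \<eta> i) * pi) * \<i>)"
    unfolding torus_char_axis by (simp add: algebra_simps)
  also have "\<dots> = 1"
    by (rule exp_integer_2pi) simp
  finally show ?thesis by (simp add: torus_char_plus)
qed

lemma continuous_on_torus_char [continuous_intros]: "continuous_on A (torus_char \<eta>)"
  unfolding torus_char_def by (intro continuous_intros)

text \<open>These will turn out to be the coefficient families of smooth functions; those of
  distributions are the \<open>slow\<close> ones.\<close>

definition rapid :: "(int ^ 'n::finite \<Rightarrow> complex) \<Rightarrow> bool" where
  "rapid c \<longleftrightarrow> (\<forall>k. \<exists>C. \<forall>\<eta>. norm (c \<eta>) * weight \<eta> ^ k \<le> C)"

definition slow :: "(int ^ 'n::finite \<Rightarrow> complex) \<Rightarrow> bool" where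
  "slow c \<longleftrightarrow> (\<exists>k C. \<forall>\<eta>. norm (c \<eta>) \<le> C * weight \<eta> ^ k)"

lemma slow_nonneg_const:
  fixes c :: "int ^ 'n::finite \<Rightarrow> complex"
  assumes "slow c"
  shows "\<exists>C\<ge>0. \<exists>k. \<forall>\<eta>. norm (c \<eta>) \<le> C * weight \<eta> ^ k"
proof -
  from assms obtain k C where kC: "\<And>\<eta>. norm (c \<eta>) \<le> C * weight \<eta> ^ k"
    by (auto simp: slow_def)
  have "0 \<le> C * weight (0 :: int ^ 'n) ^ k" using kC[of 0] norm_ge_zero[of "c 0"] by linarith
  then have "C \<ge> 0" by (simp add: weight_def)
  with kC show ?thesis by auto
qed

lemma slow_add:
  assumes "slow c" "slow d" shows "slow (\<lambda>\<eta>. c \<eta> + d \<eta>)"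
proof -
  obtain C k where 1: "C \<ge> 0" "\<And>\<eta>. norm (c \<eta>) \<le> C * weight \<eta> ^ k"
    using slow_nonneg_const[OF assms(1)] by auto
  obtain D l where 2: "D \<ge> 0" "\<And>\<eta>. norm (d \<eta>) \<le> D * weight \<eta> ^ l"
    using slow_nonneg_const[OF assms(2)] by auto
  have "norm (c \<eta> + d \<eta>) \<le> (C + D) * weight \<eta> ^ (k + l)" for \<eta>
  proof -
    have "C * weight \<eta> ^ k \<le> C * weight \<eta> ^ (k + l)" "D * weight \<eta> ^ l \<le> D * weight \<eta> ^ (k + l)"
      using 1(1) 2(1) by (auto intro!: mult_left_mono power_increasing weight_ge_1)
    then show ?thesis
      using norm_triangle_ineq[of "c \<eta>" "d \<eta>"] 1(2)[of \<eta>] 2(2)[of \<eta>] by (simp add: algebra_simps)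
  qed
  then show ?thesis unfolding slow_def by blast
qed

lemma slow_mult:
  assumes "slow c" "slow d" shows "slow (\<lambda>\<eta>. c \<eta> * d \<eta>)"
proof -
  obtain C k where 1: "C \<ge> 0" "\<And>\<eta>. norm (c \<eta>) \<le> C * weight \<eta> ^ k"
    using slow_nonneg_const[OF assms(1)] by auto
  obtain D l where 2: "D \<ge> 0" "\<And>\<eta>. norm (d \<eta>) \<le> D * weight \<eta> ^ l"
    using slow_nonneg_const[OF assms(2)] by auto
  have "norm (c \<eta> * d \<eta>) \<le> (C * D) * weight \<eta> ^ (k + l)" for \<eta>
  proof -
    have "norm (c \<eta>) * norm (d \<eta>) \<le> (C * weight \<eta> ^ k) * (D * weight \<eta> ^ l)"
      using 1 2 weight_pos[of \<eta>] by (intro mult_mono) auto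
    then show ?thesis by (simp add: norm_mult power_add algebra_simps)
  qed
  then show ?thesis unfolding slow_def by blast
qed

lemma slow_bounded: "(\<And>\<eta>. norm (c \<eta>) \<le> C) \<Longrightarrow> slow c"
  unfolding slow_def by (rule exI[of _ 0]) auto

lemma slow_const: "slow (\<lambda>_. a)"
  by (rule slow_bounded[of _ "norm a"]) simp

lemma slow_sum: "finite I \<Longrightarrow> (\<And>i. i \<in> I \<Longrightarrow> slow (c i)) \<Longrightarrow> slow (\<lambda>\<eta>. \<Sum>i\<in>I. c i \<eta>)"
  by (induction I rule: finite_induct) (simp_all add: slow_const slow_add)

lemma slow_prod: "finite I \<Longrightarrow> (\<And>i. i \<in> I \<Longrightarrow> slow (c i)) \<Longrightarrow> slow (\<lambda>\<eta>. \<Prod>i\<in>I. c i \<eta>)"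
  by (induction I rule: finite_induct) (simp_all add: slow_const slow_mult)

lemma slow_nth: "slow (\<lambda>\<eta>. complex_of_real (real_of_int (vec_nth \<eta> i)))"
proof -
  have "norm (complex_of_real (real_of_int (vec_nth \<eta> i))) \<le> 1 * weight \<eta> ^ 1" for \<eta>
    using abs_nth_le_weight[of \<eta> i] by simp
  then show ?thesis unfolding slow_def by blast
qed

lemma rapid_mult_slow:
  assumes "rapid c" "slow d" shows "rapid (\<lambda>\<eta>. d \<eta> * c \<eta>)"
  unfolding rapid_def
proof
  fix k
  obtain D l where 2: "D \<ge> 0" "\<And>\<eta>. norm (d \<eta>) \<le> D * weight \<eta> ^ l"
    using slow_nonneg_const[OF assms(2)] by auto
  obtain C where C: "\<And>\<eta>. norm (c \<eta>) * weight \<eta> ^ (l + k) \<le> C"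
    using assms(1) unfolding rapid_def by blast
  have "norm (d \<eta> * c \<eta>) * weight \<eta> ^ k \<le> D * C" for \<eta>
  proof -
    have "norm (d \<eta>) * (norm (c \<eta>) * weight \<eta> ^ k) \<le> (D * weight \<eta> ^ l) * (norm (c \<eta>) * weight \<eta> ^ k)"
      using 2 weight_pos[of \<eta>] by (intro mult_right_mono) auto
    also have "\<dots> = D * (norm (c \<eta>) * weight \<eta> ^ (l + k))"
      by (simp add: power_add)
    also have "\<dots> \<le> D * C" by (intro mult_left_mono C 2)
    finally show ?thesis by (simp add: norm_mult)
  qed
  then show "\<exists>C. \<forall>\<eta>. norm (d \<eta> * c \<eta>) * weight \<eta> ^ k \<le> C" by blast
qed

lemma rapid_add:
  assumes "rapid c" "rapid d" shows "rapid (\<lambda>\<eta>. c \<eta> + d \<eta>)"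
  unfolding rapid_def
proof
  fix k
  obtain C where C: "\<And>\<eta>. norm (c \<eta>) * weight \<eta> ^ k \<le> C"
    using assms(1) unfolding rapid_def by blast
  obtain D where D: "\<And>\<eta>. norm (d \<eta>) * weight \<eta> ^ k \<le> D"
    using assms(2) unfolding rapid_def by blast
  have "norm (c \<eta> + d \<eta>) * weight \<eta> ^ k \<le> C + D" for \<eta>
  proof -
    have "norm (c \<eta> + d \<eta>) * weight \<eta> ^ k \<le> (norm (c \<eta>) + norm (d \<eta>)) * weight \<eta> ^ k"
      using weight_pos[of \<eta>] by (intro mult_right_mono norm_triangle_ineq) auto
    then show ?thesis using C[of \<eta>] D[of \<eta>] by (simp add: algebra_simps)
  qed
  then show "\<exists>C. \<forall>\<eta>. norm (c \<eta> + d \<eta>) * weight \<eta> ^ k \<le> C" by blast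
qed

lemma rapid_zero: "rapid (\<lambda>_. 0)"
  by (auto simp: rapid_def)

lemma rapid_sum: "finite I \<Longrightarrow> (\<And>i. i \<in> I \<Longrightarrow> rapid (c i)) \<Longrightarrow> rapid (\<lambda>\<eta>. \<Sum>i\<in>I. c i \<eta>)"
  by (induction I rule: finite_induct) (simp_all add: rapid_zero rapid_add)

text \<open>Lets finitely many exceptional frequencies be split off and ignored.\<close>

lemma rapid_finite_support:
  assumes "finite {\<eta>. c \<eta> \<noteq> 0}" shows "rapid c"
  unfolding rapid_def
proof
  fix k
  have "norm (c \<eta>) * weight \<eta> ^ k \<le> (\<Sum>\<eta>\<in>{\<eta>. c \<eta> \<noteq> 0}. norm (c \<eta>) * weight \<eta> ^ k)" for \<eta>
  proof (cases "c \<eta> = 0")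
    case True
    then show ?thesis by (auto intro!: sum_nonneg)
  next
    case False
    then show ?thesis
      using assms by (intro member_le_sum) auto
  qed
  then show "\<exists>C. \<forall>\<eta>. norm (c \<eta>) * weight \<eta> ^ k \<le> C" by blast
qed

text \<open>Decay by \<open>2 * CARD('n)\<close> further powers is traded for summability.\<close>

lemma rapid_summable:
  assumes "rapid c" shows "(\<lambda>\<eta> :: int ^ 'n::finite. norm (c \<eta>) * weight \<eta> ^ k) summable_on UNIV"
proof -
  let ?K = "2 * CARD('n)"
  obtain C where C: "\<And>\<eta>. norm (c \<eta>) * weight \<eta> ^ (k + ?K) \<le> C"
    using assms unfolding rapid_def by blast
  have *: "norm (c \<eta>) * weight \<eta> ^ k \<le> C * inverse (weight \<eta> ^ ?K)" for \<eta>
    using C[of \<eta>] weight_pos[of \<eta>] by (simp add: power_add field_simps)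
  show ?thesis
    by (rule summable_on_comparison_test[OF summable_on_cmult_right[OF summable_inverse_weight, of C]])
      (use * in auto)
qed

lemma rapid_summable_0: "rapid c \<Longrightarrow> (\<lambda>\<eta>. norm (c \<eta>)) summable_on UNIV"
  using rapid_summable[of c 0] by simp

section \<open>Smooth Fourier series\<close>

definition fourier_sum :: "(int ^ 'n::finite \<Rightarrow> complex) \<Rightarrow> real ^ 'n \<Rightarrow> complex" where
  "fourier_sum c y = (\<Sum>\<^sub>\<infinity>\<eta>. c \<eta> * torus_char \<eta> y)"

text \<open>The Fourier multiplier of \<open>partial i\<close>.\<close>

definition dcoeff :: "'n::finite \<Rightarrow> (int ^ 'n \<Rightarrow> complex) \<Rightarrow> int ^ 'n \<Rightarrow> complex" where
  "dcoeff i c = (\<lambda>\<eta>. \<i> * complex_of_real (real_of_int (vec_nth \<eta> i)) * c \<eta>)"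

lemma rapid_dcoeff: "rapid c \<Longrightarrow> rapid (dcoeff i c)"
  unfolding dcoeff_def by (intro rapid_mult_slow slow_mult slow_const slow_nth)

lemma rapid_fold_dcoeff: "rapid c \<Longrightarrow> rapid (fold dcoeff is c)"
  by (induction "is" arbitrary: c) (simp_all add: rapid_dcoeff)

lemma norm_dcoeff_le: "norm (dcoeff i c \<eta>) \<le> weight \<eta> * norm (c \<eta>)"
  using abs_nth_le_weight[of \<eta> i] by (simp add: dcoeff_def norm_mult mult_right_mono)

lemma norm_fold_dcoeff_le: "norm (fold dcoeff is c \<eta>) \<le> weight \<eta> ^ length is * norm (c \<eta>)"
proof (induction "is" arbitrary: c)
  case (Cons i "is")
  have "norm (fold dcoeff is (dcoeff i c) \<eta>) \<le> weight \<eta> ^ length is * norm (dcoeff i c \<eta>)"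
    by (rule Cons.IH)
  also have "\<dots> \<le> weight \<eta> ^ length is * (weight \<eta> * norm (c \<eta>))"
    by (intro mult_left_mono norm_dcoeff_le) simp
  finally show ?case by (simp add: algebra_simps)
qed simp

lemma has_sum_diff:
  fixes f g :: "'a \<Rightarrow> 'b::real_normed_vector"
  assumes "(f has_sum a) A" "(g has_sum b) A"
  shows "((\<lambda>x. f x - g x) has_sum (a - b)) A"
  using has_sum_add[OF assms(1), of "\<lambda>x. - g x" "- b"] assms(2) by (simp add: has_sum_uminus)

lemma has_sum_sum:
  fixes f :: "'i \<Rightarrow> 'a \<Rightarrow> 'b::topological_comm_monoid_add"
  shows "(\<And>i. i \<in> I \<Longrightarrow> (f i has_sum s i) A) \<Longrightarrow> ((\<lambda>x. \<Sum>i\<in>I. f i x) has_sum (\<Sum>i\<in>I. s i)) A"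
  by (induction I rule: infinite_finite_induct) (auto intro: has_sum_add has_sum_0)

lemma has_sum_fourier_sum:
  assumes "rapid c" shows "((\<lambda>\<eta>. c \<eta> * torus_char \<eta> y) has_sum fourier_sum c y) UNIV"
  unfolding fourier_sum_def
  by (rule has_sum_infsum, rule abs_summable_summable)
    (simp add: norm_mult rapid_summable_0[OF assms])

lemma norm_fourier_sum_le:
  assumes "rapid c" shows "norm (fourier_sum c y) \<le> (\<Sum>\<^sub>\<infinity>\<eta>. norm (c \<eta>))"
  by (rule norm_infsum_le[OF has_sum_fourier_sum[OF assms, of y] has_sum_infsum[OF rapid_summable_0[OF assms]]])
    (simp add: norm_mult)

text \<open>This replaces termwise differentiation theorems: the second-order remainders of the characters
  can be summed directly.\<close>

lemma has_derivative_quadratic_remainder: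
  fixes f :: "'a::real_normed_vector \<Rightarrow> 'b::real_normed_vector"
  assumes D: "bounded_linear D" and le: "\<And>h. norm (f (y + h) - f y - D h) \<le> K * (norm h)\<^sup>2"
  shows "(f has_derivative D) (at y)"
  unfolding has_derivative_at
proof (intro conjI D)
  have lim: "((\<lambda>h. K * norm h) \<longlongrightarrow> 0) (at (0::'a))"
    by (rule tendsto_eq_intros refl | simp)+
  show "((\<lambda>h. norm (f (y + h) - f y - D h) / norm h) \<longlongrightarrow> 0) (at 0)"
  proof (rule tendsto_sandwich[OF _ _ tendsto_const lim])
    show "\<forall>\<^sub>F h in at 0. norm (f (y + h) - f y - D h) / norm h \<le> K * norm h"
    proof (rule always_eventually, rule allI)
      fix h show "norm (f (y + h) - f y - D h) / norm h \<le> K * norm h"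
        using le[of h] by (cases "h = 0") (simp_all add: field_simps power2_eq_square)
    qed
  qed simp
qed

text \<open>On the imaginary axis the exponential has modulus 1, so the constant is uniform in
  \<open>x\<close>, hence uniform over all characters.\<close>

lemma norm_exp_ii_remainder_le: "norm (exp (\<i> * complex_of_real x) - 1 - \<i> * complex_of_real x) \<le> x\<^sup>2"
  using Taylor_exp[of "\<i> * complex_of_real x" 1] by (simp add: norm_mult power2_eq_square diff_diff_eq)

lemma inner_freq: "inner h (freq \<eta>) = (\<Sum>i\<in>UNIV. vec_nth h i * real_of_int (vec_nth \<eta> i))"
  by (simp add: inner_vec_def)

lemma fourier_sum_has_derivative:
  fixes c :: "int ^ 'n::finite \<Rightarrow> complex"
  assumes c: "rapid c"
  shows "(fourier_sum c has_derivative
    (\<lambda>h. \<Sum>i\<in>UNIV. complex_of_real (vec_nth h i) * fourier_sum (dcoeff i c) y)) (at y)"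
proof (rule has_derivative_quadratic_remainder)
  show "bounded_linear (\<lambda>h :: real ^ 'n. \<Sum>i\<in>UNIV. complex_of_real (vec_nth h i) * fourier_sum (dcoeff i c) y)"
    by (intro bounded_linear_sum bounded_linear_mult_const
        bounded_linear_compose[OF bounded_linear_of_real bounded_linear_vec_nth])
next
  fix h :: "real ^ 'n"
  let ?S = "\<Sum>\<^sub>\<infinity>\<eta>. norm (c \<eta>) * weight \<eta> ^ 2"
  let ?r = "\<lambda>\<eta>. c \<eta> * torus_char \<eta> (y + h) - c \<eta> * torus_char \<eta> y
      - (\<Sum>i\<in>UNIV. complex_of_real (vec_nth h i) * (dcoeff i c \<eta> * torus_char \<eta> y))"
  have "(?r has_sum (fourier_sum c (y + h) - fourier_sum c y
      - (\<Sum>i\<in>UNIV. complex_of_real (vec_nth h i) * fourier_sum (dcoeff i c) y))) UNIV"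
    by (intro has_sum_diff has_sum_sum has_sum_cmult_right has_sum_fourier_sum c rapid_dcoeff)
  moreover have "((\<lambda>\<eta>. (norm (c \<eta>) * weight \<eta> ^ 2) * (norm h)\<^sup>2) has_sum (?S * (norm h)\<^sup>2)) UNIV"
    by (intro has_sum_cmult_left has_sum_infsum rapid_summable c)
  moreover have "norm (?r \<eta>) \<le> (norm (c \<eta>) * weight \<eta> ^ 2) * (norm h)\<^sup>2" for \<eta>
  proof -
    let ?x = "inner h (freq \<eta>)"
    \<comment> \<open>The character at \<open>y\<close> factors out and leaves the Taylor remainder
      of the exponential at \<open>inner h (freq \<eta>)\<close>, of size at most
      \<open>(norm h * weight \<eta>)^2\<close>.\<close>
    have "?r \<eta> = c \<eta> * torus_char \<eta> y * (exp (\<i> * complex_of_real ?x) - 1 - \<i> * complex_of_real ?x)"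
      by (simp add: torus_char_plus torus_char_def[of \<eta> h] inner_freq dcoeff_def sum_distrib_left
          sum_distrib_right algebra_simps)
    then have "norm (?r \<eta>) = norm (c \<eta>) * norm (exp (\<i> * complex_of_real ?x) - 1 - \<i> * complex_of_real ?x)"
      by (simp add: norm_mult)
    also have "\<dots> \<le> norm (c \<eta>) * (norm h * weight \<eta>)\<^sup>2"
    proof (intro mult_left_mono order_trans[OF norm_exp_ii_remainder_le])
      have "\<bar>?x\<bar> \<le> norm h * norm (freq \<eta>)" by (rule Cauchy_Schwarz_ineq2)
      also have "\<dots> \<le> norm h * weight \<eta>" by (intro mult_left_mono norm_freq_le_weight) simp
      finally show "?x\<^sup>2 \<le> (norm h * weight \<eta>)\<^sup>2" by (metis abs_ge_zero power2_abs power_mono)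
    qed simp
    finally show ?thesis by (simp add: algebra_simps)
  qed
  ultimately show "norm (fourier_sum c (y + h) - fourier_sum c y
      - (\<Sum>i\<in>UNIV. complex_of_real (vec_nth h i) * fourier_sum (dcoeff i c) y)) \<le> ?S * (norm h)\<^sup>2"
    by (rule norm_infsum_le)
qed

lemma partial_eqI: "(f has_derivative D) (at y) \<Longrightarrow> partial i f y = D (axis i 1)"
  by (simp add: partial_def frechet_derivative_at[symmetric])

lemma partial_fourier_sum:
  assumes "rapid c" shows "partial i (fourier_sum c) = fourier_sum (dcoeff i c)"
proof
  fix y
  have "partial i (fourier_sum c) y
      = (\<Sum>j\<in>UNIV. complex_of_real (vec_nth (axis i 1) j) * fourier_sum (dcoeff j c) y)"
    by (rule partial_eqI[OF fourier_sum_has_derivative[OF assms]])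
  also have "\<dots> = (\<Sum>j\<in>UNIV. if j = i then fourier_sum (dcoeff j c) y else 0)"
    by (intro sum.cong) (auto simp: axis_def)
  finally show "partial i (fourier_sum c) y = fourier_sum (dcoeff i c) y" by simp
qed

lemma partials_fourier_sum:
  "rapid c \<Longrightarrow> partials is (fourier_sum c) = fourier_sum (fold dcoeff is c)"
  by (induction "is" arbitrary: c) (simp_all add: partials_def partial_fourier_sum rapid_dcoeff)

lemma fourier_sum_smooth:
  assumes "rapid c" shows "fourier_sum c \<in> torus_smooth"
  unfolding torus_smooth_def
proof (intro CollectI conjI allI)
  show "fourier_sum c (y + axis i (2 * pi)) = fourier_sum c y" for i y
    by (simp add: fourier_sum_def torus_char_periodic)
  show "partials is (fourier_sum c) differentiable (at y)" for "is" y
    unfolding partials_fourier_sum[OF assms] differentiable_def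
    using fourier_sum_has_derivative[OF rapid_fold_dcoeff[OF assms]] by blast
qed

lemma norm_partials_fourier_sum_le:
  assumes "rapid c" "length is \<le> k"
  shows "norm (partials is (fourier_sum c) y) \<le> (\<Sum>\<^sub>\<infinity>\<eta>. norm (c \<eta>) * weight \<eta> ^ k)"
proof -
  have "norm (fourier_sum (fold dcoeff is c) y) \<le> (\<Sum>\<^sub>\<infinity>\<eta>. norm (fold dcoeff is c \<eta>))"
    by (intro norm_fourier_sum_le rapid_fold_dcoeff assms)
  also have "\<dots> \<le> (\<Sum>\<^sub>\<infinity>\<eta>. norm (c \<eta>) * weight \<eta> ^ k)"
  proof (intro infsum_mono rapid_summable_0 rapid_summable rapid_fold_dcoeff assms)
    fix \<eta>
    have "norm (fold dcoeff is c \<eta>) \<le> weight \<eta> ^ length is * norm (c \<eta>)"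
      by (rule norm_fold_dcoeff_le)
    also have "\<dots> \<le> weight \<eta> ^ k * norm (c \<eta>)"
      by (intro mult_right_mono power_increasing weight_ge_1 assms) simp
    finally show "norm (fold dcoeff is c \<eta>) \<le> norm (c \<eta>) * weight \<eta> ^ k" by (simp add: mult.commute)
  qed
  finally show ?thesis by (simp add: partials_fourier_sum[OF assms(1)])
qed

text \<open>Each derivative costs one factor of \<open>weight\<close>. This makes the tails of a
  rapid Fourier series small in every seminorm, which is what continuity of a distribution can
  use.\<close>

lemma Ck_norm_fourier_sum_le:
  assumes "rapid c"
  shows "Ck_norm k (fourier_sum c) \<le> (\<Sum>\<^sub>\<infinity>\<eta>. norm (c \<eta>) * weight \<eta> ^ k)"
  unfolding Ck_norm_def
proof (rule cSup_least)
  show "{norm (partials is (fourier_sum c) y) |is y. length is \<le> k} \<noteq> {}"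
    by (auto intro!: exI[of _ "[]"])
qed (auto intro: norm_partials_fourier_sum_le[OF assms])

section \<open>Integration over the torus\<close>

lemma periodic_shift:
  fixes g :: "real ^ 'n::finite \<Rightarrow> 'a" and k :: int
  assumes per: "\<And>y. g (y + axis i (2 * pi)) = g y"
  shows "g (y + axis i (2 * pi * of_int k)) = g y"
proof (induction k arbitrary: y rule: int_induct[where k = 0])
  case base
  have "axis i 0 = (0 :: real ^ 'n)" by (simp add: Finite_Cartesian_Product.vec_eq_iff axis_def)
  then show ?case by (simp only: of_int_0 mult_zero_right add_0_right)
next
  case (step1 k)
  have "y + axis i (2 * pi * of_int (k + 1)) = (y + axis i (2 * pi * of_int k)) + axis i (2 * pi)"
    by (simp add: Finite_Cartesian_Product.vec_eq_iff axis_def algebra_simps)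
  then show ?case by (simp only: per step1)
next
  case (step2 k)
  have "y + axis i (2 * pi * of_int k) = (y + axis i (2 * pi * of_int (k - 1))) + axis i (2 * pi)"
    by (simp add: Finite_Cartesian_Product.vec_eq_iff axis_def algebra_simps)
  then show ?case by (metis per step2(2))
qed

lemma periodic_box_representative:
  fixes g :: "real ^ 'n::finite \<Rightarrow> 'a"
  assumes per: "\<And>i y. g (y + axis i (2 * pi)) = g y"
  shows "\<exists>z\<in>cbox 0 (\<chi> i. 2 * pi). g y = g z"
proof -
  let ?k = "\<lambda>i. \<lfloor>vec_nth y i / (2 * pi)\<rfloor>"
  \<comment> \<open>The coordinates are reduced one at a time, hence the induction over a finite set
    \<open>I\<close> of them.\<close>
  have *: "g (y + (\<Sum>i\<in>I. axis i (2 * pi * of_int (- ?k i)))) = g y" if "finite I" for I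
    using that
  proof (induction I rule: finite_induct)
    case (insert j I)
    have "g (y + (\<Sum>i\<in>insert j I. axis i (2 * pi * of_int (- ?k i))))
        = g ((y + (\<Sum>i\<in>I. axis i (2 * pi * of_int (- ?k i)))) + axis j (2 * pi * of_int (- ?k j)))"
      using insert by (simp add: add_ac)
    also have "\<dots> = g (y + (\<Sum>i\<in>I. axis i (2 * pi * of_int (- ?k i))))"
      by (rule periodic_shift[where g = g, OF per])
    finally show ?case using insert.IH by simp
  qed simp
  define z where "z = y + (\<Sum>i\<in>UNIV. axis i (2 * pi * of_int (- ?k i)))"
  have z: "vec_nth z i = vec_nth y i - 2 * pi * of_int (?k i)" for i
    by (simp add: z_def axis_def if_distrib cong: if_cong)
  have "z \<in> cbox 0 (\<chi> i. 2 * pi)"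
    unfolding mem_box_cart
  proof
    fix i
    have "of_int (?k i) \<le> vec_nth y i / (2 * pi)" "vec_nth y i / (2 * pi) < of_int (?k i) + 1"
      by linarith+
    then have "of_int (?k i) * (2 * pi) \<le> vec_nth y i" "vec_nth y i < (of_int (?k i) + 1) * (2 * pi)"
      by (simp_all only: pos_le_divide_eq pos_divide_less_eq mult_pos_pos pi_gt_zero zero_less_numeral)
    then show "vec_nth 0 i \<le> vec_nth z i \<and> vec_nth z i \<le> vec_nth (\<chi> i. 2 * pi) i"
      by (simp add: z algebra_simps)
  qed
  moreover have "g y = g z" using *[of UNIV] by (simp add: z_def)
  ultimately show ?thesis by blast
qed

lemma continuous_periodic_bounded:
  fixes g :: "real ^ 'n::finite \<Rightarrow> complex"
  assumes "continuous_on UNIV g" and per: "\<And>i y. g (y + axis i (2 * pi)) = g y"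
  shows "\<exists>B. \<forall>y. norm (g y) \<le> B"
proof -
  have "compact (g ` cbox 0 (\<chi> i. 2 * pi))"
    by (intro compact_continuous_image continuous_on_subset[OF assms(1)]) auto
  then obtain B where B: "\<And>z. z \<in> cbox 0 (\<chi> i. 2 * pi) \<Longrightarrow> norm (g z) \<le> B"
    by (metis bounded_iff compact_imp_bounded image_eqI)
  then show ?thesis using periodic_box_representative[of g, OF per] by metis
qed

lemma continuous_integrable_torus:
  fixes g :: "real ^ 'n::finite \<Rightarrow> complex"
  shows "continuous_on UNIV g \<Longrightarrow> g integrable_on cbox a b"
  by (rule integrable_continuous) (rule continuous_on_subset, auto)

lemma content_torus_box: "measure lborel (cbox 0 (\<chi> i::'n::finite. 2 * pi)) = (2 * pi) ^ CARD('n)"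
proof -
  have "cbox 0 (\<chi> i::'n. 2 * pi) \<noteq> {}" by (simp add: interval_ne_empty_cart)
  then show ?thesis by (simp add: content_cbox_cart)
qed

lemma norm_torus_integral_le:
  fixes g :: "real ^ 'n::finite \<Rightarrow> complex"
  assumes "continuous_on UNIV g" "\<And>y. norm (g y) \<le> B"
  shows "norm (torus_integral g) \<le> B * (2 * pi) ^ CARD('n)"
proof -
  have "0 \<le> B" using assms(2)[of 0] norm_ge_zero[of "g 0"] by linarith
  then show ?thesis
    using integrable_bound[OF _ continuous_integrable_torus[OF assms(1)], of B 0 "\<chi> i. 2 * pi"] assms(2)
    by (simp add: torus_integral_def content_torus_box)
qed

lemma torus_integral_cmult: "torus_integral (\<lambda>y. a * g y) = a * torus_integral g"
  by (simp add: torus_integral_def)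

lemma torus_integral_add:
  "continuous_on UNIV f \<Longrightarrow> continuous_on UNIV g \<Longrightarrow>
    torus_integral (\<lambda>y. f y + g y) = torus_integral f + torus_integral g"
  unfolding torus_integral_def by (intro Henstock_Kurzweil_Integration.integral_add continuous_integrable_torus)

lemma torus_integral_sum:
  "finite I \<Longrightarrow> (\<And>i. i \<in> I \<Longrightarrow> continuous_on UNIV (f i)) \<Longrightarrow>
    torus_integral (\<lambda>y. \<Sum>i\<in>I. f i y) = (\<Sum>i\<in>I. torus_integral (f i))"
  unfolding torus_integral_def
  by (intro Henstock_Kurzweil_Integration.integral_sum continuous_integrable_torus)

text \<open>Isolates the one coordinate in which the boxes below are cut and shifted.\<close>

lemma mem_box_cart_split:
  "x \<in> cbox (a :: real ^ 'n::finite) b \<longleftrightarrow> (vec_nth a i \<le> vec_nth x i \<and> vec_nth x i \<le> vec_nth b i) \<and>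
    (\<forall>j. j \<noteq> i \<longrightarrow> vec_nth a j \<le> vec_nth x j \<and> vec_nth x j \<le> vec_nth b j)"
proof -
  have *: "(\<forall>j. P j) \<longleftrightarrow> P i \<and> (\<forall>j. j \<noteq> i \<longrightarrow> P j)" for P
    by metis
  show ?thesis unfolding mem_box_cart by (rule *)
qed

text \<open>The translated box sticks out of the original one by a slab beyond the face where
  coordinate \<open>i\<close> is \<open>2 * pi\<close>. That slab is the translate by a full period
  of the slab missing at the opposite end, so periodicity balances the two.\<close>

lemma torus_integral_translation:
  fixes g :: "real ^ 'n::finite \<Rightarrow> complex"
  assumes cont: "continuous_on UNIV g" and per: "\<And>y. g (y + axis i (2 * pi)) = g y"
    and t: "0 \<le> t" "t \<le> 2 * pi"
  shows "torus_integral (\<lambda>y. g (y + axis i t)) = torus_integral g"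
proof -
  let ?b = "\<chi> i::'n. 2 * pi" and ?k = "axis i 1 :: real ^ 'n"
  let ?b' = "\<chi> j. if j = i then t else 2 * pi"
  note int = integrable_integral[OF continuous_integrable_torus[OF cont]]
  have b: "?k \<in> Basis" by simp
  have nth: "inner x ?k = vec_nth x i" for x by (simp add: inner_axis)
  have axis_nth: "vec_nth (axis i s) j = (if j = i then s else 0)" for s :: real and j
    by (simp add: axis_def)
  have A1: "cbox 0 ?b \<inter> {x. inner x ?k \<le> t} = cbox 0 ?b'"
    by (rule Set.set_eqI) (use t in \<open>auto simp: mem_box_cart_split[of _ _ _ i] nth axis_nth\<close>)
  have A2: "cbox 0 ?b \<inter> {x. inner x ?k \<ge> t} = cbox (axis i t) ?b"
    by (rule Set.set_eqI) (use t in \<open>auto simp: mem_box_cart_split[of _ _ _ i] nth axis_nth\<close>)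
  have B1: "cbox (axis i t) (?b + axis i t) \<inter> {x. inner x ?k \<le> 2 * pi} = cbox (axis i t) ?b"
    by (rule Set.set_eqI) (use t in \<open>auto simp: mem_box_cart_split[of _ _ _ i] nth axis_nth\<close>)
  have B2: "cbox (axis i t) (?b + axis i t) \<inter> {x. inner x ?k \<ge> 2 * pi}
      = cbox (0 + axis i (2 * pi)) (?b' + axis i (2 * pi))"
    by (rule Set.set_eqI) (use t in \<open>auto simp: mem_box_cart_split[of _ _ _ i] nth axis_nth\<close>)
  have "torus_integral g = integral (cbox 0 ?b') g + integral (cbox (axis i t) ?b) g"
    unfolding torus_integral_def
    by (rule integral_unique[OF has_integral_split[of _ _ _ _ ?k t, OF _ _ b]]) (simp_all only: A1 A2 int)
  moreover have "integral (cbox (0 + axis i t) (?b + axis i t)) g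
      = integral (cbox (axis i t) ?b) g + integral (cbox (0 + axis i (2 * pi)) (?b' + axis i (2 * pi))) g"
    by (rule integral_unique[OF has_integral_split[of _ _ _ _ ?k "2 * pi", OF _ _ b]])
      (simp_all only: add_0 B1 B2 int)
  moreover have "integral (cbox (0 + axis i (2 * pi)) (?b' + axis i (2 * pi))) g = integral (cbox 0 ?b') g"
    by (subst integral_shift_cbox_plus[symmetric]) (simp add: comp_def per add.commute)
  moreover have "integral (cbox (0 + axis i t) (?b + axis i t)) g = torus_integral (\<lambda>y. g (y + axis i t))"
    by (subst integral_shift_cbox_plus[symmetric]) (simp add: comp_def torus_integral_def add.commute)
  ultimately show ?thesis by (simp only: add.commute)
qed

text \<open>Differentiating the translation invariance of the integral avoids iterated integrals.\<close>

lemma torus_integral_derivative_zero: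
  fixes g :: "real ^ 'n::finite \<Rightarrow> complex"
  assumes per: "\<And>y. g (y + axis i (2 * pi)) = g y"
    and der: "\<And>y. (g has_derivative g' y) (at y)"
    and cont': "continuous_on UNIV (\<lambda>y. g' y (axis i 1))"
  shows "torus_integral (\<lambda>y. g' y (axis i 1)) = 0"
proof -
  \<comment> \<open>Translation invariance is available for \<open>t\<close> between 0 and
    \<open>2 * pi\<close> only, so the derivative at 0 is taken within this interval, where it is
    still unique.\<close>
  let ?U = "{0..2 * pi}"
  have cont: "continuous_on UNIV g"
    using der by (intro continuous_at_imp_continuous_on ballI has_derivative_continuous)
  have axis: "axis i t = t *\<^sub>R (axis i 1 :: real ^ 'n)" for t
    by (simp add: Finite_Cartesian_Product.vec_eq_iff axis_def)
  have "((\<lambda>t. torus_integral (\<lambda>y. g (y + t *\<^sub>R axis i 1))) has_vector_derivative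
      integral (cbox 0 (\<chi> i. 2 * pi)) (\<lambda>y. g' (y + 0 *\<^sub>R axis i 1) (axis i 1))) (at 0 within ?U)"
    unfolding torus_integral_def
  proof (rule leibniz_rule_vector_derivative)
    fix t y
    have "((\<lambda>t. g (y + t *\<^sub>R axis i 1)) has_derivative (\<lambda>h. g' (y + t *\<^sub>R axis i 1) (h *\<^sub>R axis i 1))) (at t within ?U)"
      by (rule has_derivative_compose[OF _ der]) (auto intro!: derivative_eq_intros)
    moreover have "linear (g' (y + t *\<^sub>R axis i 1))" using der has_derivative_linear by blast
    ultimately show "((\<lambda>t. g (y + t *\<^sub>R axis i 1)) has_vector_derivative g' (y + t *\<^sub>R axis i 1) (axis i 1)) (at t within ?U)"
      by (simp add: has_vector_derivative_def linear_scale)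
  next
    fix t show "(\<lambda>y. g (y + t *\<^sub>R axis i 1)) integrable_on cbox 0 (\<chi> i. 2 * pi)"
      by (intro continuous_integrable_torus continuous_on_compose2[OF cont] continuous_intros) auto
  next
    show "continuous_on (?U \<times> cbox 0 (\<chi> i. 2 * pi)) (\<lambda>(t, y). g' (y + t *\<^sub>R axis i 1) (axis i 1))"
      unfolding case_prod_beta
      by (intro continuous_on_compose2[OF cont'] continuous_intros) auto
  qed auto
  moreover have "((\<lambda>t. torus_integral (\<lambda>y. g (y + t *\<^sub>R axis i 1))) has_vector_derivative 0) (at 0 within ?U)"
  proof (rule has_vector_derivative_transform[where f = "\<lambda>_. torus_integral g"])
    show "torus_integral (\<lambda>y. g (y + t *\<^sub>R axis i 1)) = torus_integral g" if "t \<in> ?U" for t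
      using torus_integral_translation[OF cont per, of t] that by (simp flip: axis)
  qed auto
  ultimately have "integral (cbox 0 (\<chi> i. 2 * pi)) (\<lambda>y. g' (y + 0 *\<^sub>R axis i 1) (axis i 1)) = 0"
    using vector_derivative_unique_within_closed_interval[of 0 "2 * pi" 0] by simp
  then show ?thesis by (simp add: torus_integral_def)
qed

section \<open>Decay of the Fourier coefficients of smooth functions\<close>

lemma torus_smoothD:
  assumes "\<phi> \<in> torus_smooth"
  shows "\<phi> (y + axis i (2 * pi)) = \<phi> y" "partials is \<phi> differentiable (at y)" "\<phi> differentiable (at y)"
  using assms by (auto simp: torus_smooth_def partials_def dest: spec[of _ "[]"])

lemma torus_smooth_continuous: "\<phi> \<in> torus_smooth \<Longrightarrow> continuous_on A \<phi>"
  by (intro continuous_at_imp_continuous_on ballI differentiable_imp_continuous_within torus_smoothD)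

text \<open>Only periodicity needs an argument: composing with the shift by one period transports
  the derivative at \<open>y\<close> to the shifted point.\<close>

lemma partial_smooth:
  fixes \<phi> :: "real ^ 'n::finite \<Rightarrow> complex"
  assumes "\<phi> \<in> torus_smooth" shows "partial i \<phi> \<in> torus_smooth"
  unfolding torus_smooth_def
proof (intro CollectI conjI allI)
  fix "is" :: "'n list" and y
  show "partials is (partial i \<phi>) differentiable (at y)"
    using torus_smoothD(2)[OF assms, of "i # is" y] by (simp add: partials_def)
next
  fix j y
  let ?a = "axis j (2 * pi) :: real ^ 'n"
  obtain D where D: "(\<phi> has_derivative D) (at y)"
    using torus_smoothD(3)[OF assms] by (auto simp: differentiable_def)
  have per: "\<phi> (z - ?a) = \<phi> z" for z
    using torus_smoothD(1)[OF assms, of "z - ?a" j] by simp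
  have "((\<lambda>z. z - ?a) has_derivative (\<lambda>h. h)) (at (y + ?a))"
    by (auto intro!: derivative_eq_intros)
  moreover have "(\<phi> has_derivative D) (at (y + ?a - ?a))" using D by simp
  ultimately have "((\<lambda>z. \<phi> (z - ?a)) has_derivative (\<lambda>h. D h)) (at (y + ?a))"
    by (rule has_derivative_compose)
  then have "(\<phi> has_derivative D) (at (y + ?a))" by (simp add: per)
  then show "partial i \<phi> (y + ?a) = partial i \<phi> y"
    using D by (simp add: partial_eqI)
qed

lemma partials_smooth: "\<phi> \<in> torus_smooth \<Longrightarrow> partials is \<phi> \<in> torus_smooth"
  unfolding partials_def by (induction "is" arbitrary: \<phi>) (simp_all add: partial_smooth)

lemma torus_smooth_bounded:
  assumes "\<phi> \<in> torus_smooth" shows "\<exists>B. \<forall>y. norm (\<phi> y) \<le> B"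
  by (rule continuous_periodic_bounded) (use assms in \<open>auto intro: torus_smooth_continuous torus_smoothD\<close>)

text \<open>The \<open>Sup\<close> in \<open>Ck_norm\<close> is informative only over a bounded set.
  There are finitely many lists of directions of length at most \<open>k\<close>, and each
  derivative is continuous and periodic, hence bounded.\<close>

lemma norm_partials_le_Ck_norm:
  fixes \<phi> :: "real ^ 'n::finite \<Rightarrow> complex"
  assumes "\<phi> \<in> torus_smooth" "length is \<le> k"
  shows "norm (partials is \<phi> y) \<le> Ck_norm k \<phi>"
  unfolding Ck_norm_def
proof (rule cSup_upper)
  have "\<forall>is. \<exists>B. \<forall>y. norm (partials is \<phi> y) \<le> B"
    using torus_smooth_bounded[OF partials_smooth[OF assms(1)]] by blast
  then obtain B where B: "\<And>is y. norm (partials is \<phi> y) \<le> B is" by metis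
  have fin: "finite {is :: 'n list. length is \<le> k}"
    using finite_lists_length_le[of "UNIV :: 'n set" k] by simp
  show "bdd_above {norm (partials is \<phi> y) |is y. length is \<le> k}"
  proof (rule bdd_aboveI, clarify)
    fix js :: "'n list" and y assume "length js \<le> k"
    then have "B js \<le> Max (B ` {is. length is \<le> k})"
      using fin by (intro Max_ge) auto
    then show "norm (partials js \<phi> y) \<le> Max (B ` {is. length is \<le> k})"
      using B[of js y] by linarith
  qed
qed (use assms in blast)

lemma Ck_norm_nonneg: "\<phi> \<in> torus_smooth \<Longrightarrow> 0 \<le> Ck_norm k \<phi>"
  by (rule order_trans[OF norm_ge_zero norm_partials_le_Ck_norm[of \<phi> "[]" k 0]]) auto

section \<open>Integration by parts against characters\<close>

lemma torus_char_has_derivative: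
  "(torus_char \<eta> has_derivative (\<lambda>h. \<i> * complex_of_real (inner h (freq \<eta>)) * torus_char \<eta> y)) (at y)"
proof -
  have "((\<lambda>y. \<i> * complex_of_real (inner y (freq \<eta>))) has_derivative
      (\<lambda>h. \<i> * complex_of_real (inner h (freq \<eta>)))) (at y)"
    by (intro derivative_intros bounded_linear_imp_has_derivative bounded_linear_compose[OF bounded_linear_of_real]
        bounded_linear_inner_left)
  from has_derivative_compose[OF this DERIV_exp[unfolded has_field_derivative_def]] show ?thesis
    by (simp add: torus_char_def[abs_def] mult.commute)
qed

text \<open>Mind the sign: up to the factor \<open>(2 * pi) ^ CARD('n)\<close> this is the Fourier
  coefficient at \<open>- \<eta>\<close>. Without conjugation it is the pairing of the character, as
  a distribution, with a test function.\<close>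

definition char_pairing :: "int ^ 'n::finite \<Rightarrow> (real ^ 'n \<Rightarrow> complex) \<Rightarrow> complex" where
  "char_pairing \<eta> \<phi> = torus_integral (\<lambda>y. torus_char \<eta> y * \<phi> y)"

lemma char_pairing_cmult: "char_pairing \<eta> (\<lambda>y. a * \<phi> y) = a * char_pairing \<eta> \<phi>"
  by (simp add: char_pairing_def mult.left_commute torus_integral_cmult)

lemma char_pairing_add:
  "continuous_on UNIV \<phi> \<Longrightarrow> continuous_on UNIV \<psi> \<Longrightarrow>
    char_pairing \<eta> (\<lambda>y. \<phi> y + \<psi> y) = char_pairing \<eta> \<phi> + char_pairing \<eta> \<psi>"
  by (simp add: char_pairing_def distrib_left torus_integral_add continuous_on_mult continuous_on_torus_char)

lemma norm_char_pairing_le: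
  fixes \<phi> :: "real ^ 'n::finite \<Rightarrow> complex"
  assumes "continuous_on UNIV \<phi>" "\<And>y. norm (\<phi> y) \<le> B"
  shows "norm (char_pairing \<eta> \<phi>) \<le> B * (2 * pi) ^ CARD('n)"
  unfolding char_pairing_def
  by (rule norm_torus_integral_le) (use assms in \<open>auto intro!: continuous_on_mult continuous_on_torus_char simp: norm_mult\<close>)

text \<open>The derivative of the periodic product \<open>torus_char \<eta> y * \<phi> y\<close>
  integrates to zero; the product rule splits that integral into the two pairings.\<close>

lemma char_pairing_partial:
  fixes \<phi> :: "real ^ 'n::finite \<Rightarrow> complex"
  assumes \<phi>: "\<phi> \<in> torus_smooth"
  shows "char_pairing \<eta> (partial i \<phi>) = - (\<i> * complex_of_real (real_of_int (vec_nth \<eta> i))) * char_pairing \<eta> \<phi>"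
proof -
  let ?a = "\<i> * complex_of_real (real_of_int (vec_nth \<eta> i))"
  let ?D = "\<lambda>y h. torus_char \<eta> y * frechet_derivative \<phi> (at y) h
      + \<i> * complex_of_real (inner h (freq \<eta>)) * torus_char \<eta> y * \<phi> y"
  note c = torus_smooth_continuous[OF \<phi>] torus_smooth_continuous[OF partial_smooth[OF \<phi>]]
  have D: "?D y (axis i 1) = torus_char \<eta> y * partial i \<phi> y + ?a * (torus_char \<eta> y * \<phi> y)" for y
    by (simp add: partial_def inner_axis')
  have "torus_integral (\<lambda>y. ?D y (axis i 1)) = 0"
  proof (rule torus_integral_derivative_zero[where g = "\<lambda>y. torus_char \<eta> y * \<phi> y"])
    show "((\<lambda>y. torus_char \<eta> y * \<phi> y) has_derivative ?D y) (at y)" for y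
      using torus_smoothD(3)[OF \<phi>] frechet_derivative_works
      by (intro has_derivative_mult torus_char_has_derivative) blast
    show "continuous_on UNIV (\<lambda>y. ?D y (axis i 1))"
      unfolding D by (intro continuous_intros c)
  qed (simp add: torus_char_periodic torus_smoothD[OF \<phi>])
  also have "torus_integral (\<lambda>y. ?D y (axis i 1)) = char_pairing \<eta> (partial i \<phi>) + ?a * char_pairing \<eta> \<phi>"
    unfolding D char_pairing_def
    by (subst torus_integral_add) (intro continuous_intros c | simp add: torus_integral_cmult)+
  finally show ?thesis by (simp add: eq_neg_iff_add_eq_0)
qed

lemma char_pairing_partials_replicate:
  assumes "\<phi> \<in> torus_smooth"
  shows "char_pairing \<eta> (partials (replicate k i) \<phi>)
    = (- (\<i> * complex_of_real (real_of_int (vec_nth \<eta> i)))) ^ k * char_pairing \<eta> \<phi>"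
  using assms
proof (induction k arbitrary: \<phi>)
  case (Suc k)
  then show ?case
    using Suc.IH[OF partial_smooth[OF Suc.prems, of i]]
    by (simp add: partials_def char_pairing_partial del: minus_mult_minus)
qed (simp add: partials_def)

text \<open>The witness is a coordinate of largest absolute value, compared through the l1 norm;
  \<open>max 1\<close> covers frequency 0.\<close>

lemma weight_le_Max_nth:
  fixes \<eta> :: "int ^ 'n::finite"
  shows "\<exists>i. weight \<eta> \<le> (1 + real CARD('n)) * max 1 \<bar>real_of_int (vec_nth \<eta> i)\<bar>"
proof -
  let ?f = "\<lambda>i. \<bar>real_of_int (vec_nth \<eta> i)\<bar>"
  have "Max (range ?f) \<in> range ?f" by (rule Max_in) auto
  then obtain i where "Max (range ?f) = ?f i" by (rule rangeE)
  moreover have "?f j \<le> Max (range ?f)" for j by (rule Max_ge) auto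
  ultimately have i: "?f j \<le> ?f i" for j by metis
  have "norm (freq \<eta>) \<le> (\<Sum>j\<in>UNIV. \<bar>vec_nth (freq \<eta>) j\<bar>)"
    by (rule norm_le_l1_cart)
  also have "\<dots> \<le> (\<Sum>j\<in>(UNIV :: 'n set). max 1 (?f i))"
    using i by (intro sum_mono) (simp add: le_max_iff_disj)
  finally have "norm (freq \<eta>) \<le> real CARD('n) * max 1 (?f i)" by simp
  then have "weight \<eta> \<le> (1 + real CARD('n)) * max 1 (?f i)"
    by (simp add: weight_def algebra_simps)
  then show ?thesis by blast
qed

text \<open>Differentiating \<open>k\<close> times along the largest coordinate of \<eta> suffices.
  That direction varies with \<eta>, but \<open>Ck_norm k\<close> bounds all directions at once. The
  dependence on \<phi> is kept explicit because \<open>synthesis_distribution\<close> needs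
  continuity in the seminorms.\<close>

lemma char_pairing_decay:
  fixes \<phi> :: "real ^ 'n::finite \<Rightarrow> complex"
  assumes \<phi>: "\<phi> \<in> torus_smooth"
  shows "norm (char_pairing \<eta> \<phi>) * weight \<eta> ^ k
    \<le> ((1 + real CARD('n)) ^ k * (2 * pi) ^ CARD('n)) * Ck_norm k \<phi>"
proof -
  obtain i where i: "weight \<eta> \<le> (1 + real CARD('n)) * max 1 \<bar>real_of_int (vec_nth \<eta> i)\<bar>"
    using weight_le_Max_nth by blast
  let ?x = "\<bar>real_of_int (vec_nth \<eta> i)\<bar>" and ?P = "norm (char_pairing \<eta> \<phi>)"
  have bound: "norm (char_pairing \<eta> (partials is \<phi>)) \<le> Ck_norm k \<phi> * (2 * pi) ^ CARD('n)"
    if "length is \<le> k" for "is"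
    using that \<phi> by (intro norm_char_pairing_le torus_smooth_continuous partials_smooth norm_partials_le_Ck_norm)
  have "?P \<le> Ck_norm k \<phi> * (2 * pi) ^ CARD('n)"
    using bound[of "[]"] by (simp add: partials_def)
  moreover have "?P * ?x ^ k \<le> Ck_norm k \<phi> * (2 * pi) ^ CARD('n)"
    using bound[of "replicate k i"] char_pairing_partials_replicate[OF \<phi>, of \<eta> k i]
    by (simp add: norm_mult norm_power mult.commute)
  \<comment> \<open>A coordinate of size at most 1 calls for the undifferentiated bound, a larger
    one for the \<open>k\<close>-fold derivative.\<close>
  ultimately have *: "?P * max 1 ?x ^ k \<le> Ck_norm k \<phi> * (2 * pi) ^ CARD('n)"
    by (cases "?x \<le> 1") (simp_all add: max_def)
  have "?P * weight \<eta> ^ k \<le> ?P * ((1 + real CARD('n)) * max 1 ?x) ^ k"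
    using i by (intro mult_left_mono power_mono) auto
  also have "\<dots> = (1 + real CARD('n)) ^ k * (?P * max 1 ?x ^ k)"
    by (simp add: power_mult_distrib)
  also have "\<dots> \<le> (1 + real CARD('n)) ^ k * (Ck_norm k \<phi> * (2 * pi) ^ CARD('n))"
    by (intro mult_left_mono *) simp
  finally show ?thesis by (simp add: algebra_simps)
qed

lemma rapid_char_pairing:
  assumes "\<phi> \<in> torus_smooth" shows "rapid (\<lambda>\<eta>. char_pairing \<eta> \<phi>)"
  unfolding rapid_def using char_pairing_decay[OF assms] by blast

lemma rapid_uminus_index: "rapid c \<Longrightarrow> rapid (\<lambda>\<eta>. c (- \<eta>))"
  unfolding rapid_def by (metis weight_uminus)

text \<open>Viewing a character as a one-term series gives its smoothness for free.\<close>

lemma fourier_sum_single: "fourier_sum (\<lambda>\<zeta>. if \<zeta> = \<eta> then a else 0) = (\<lambda>y. a * torus_char \<eta> y)"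
proof
  fix y
  show "fourier_sum (\<lambda>\<zeta>. if \<zeta> = \<eta> then a else 0) y = a * torus_char \<eta> y"
    unfolding fourier_sum_def by (intro infsumI has_sum_finite_neutralI[of "{\<eta>}"]) auto
qed

lemma rapid_single: "rapid (\<lambda>\<zeta>. if \<zeta> = \<eta> then a else 0)"
  by (rule rapid_finite_support) simp

lemma torus_char_smooth: "torus_char \<eta> \<in> torus_smooth"
  using fourier_sum_smooth[OF rapid_single[of \<eta> 1]] by (simp add: fourier_sum_single)

text \<open>Orthogonality without computing an integral: the constant has derivative zero, so
  integration by parts multiplies its pairing by a nonzero coordinate of \<eta> and gets
  zero.\<close>

lemma char_pairing_one:
  fixes \<eta> :: "int ^ 'n::finite"
  shows "char_pairing \<eta> (\<lambda>_. 1) = (if \<eta> = 0 then complex_of_real ((2 * pi) ^ CARD('n)) else 0)"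
proof (cases "\<eta> = 0")
  case True
  then show ?thesis
    by (simp add: char_pairing_def torus_integral_def content_torus_box scaleR_conv_of_real)
next
  case False
  then obtain i where i: "vec_nth \<eta> i \<noteq> 0"
    by (auto simp: Finite_Cartesian_Product.vec_eq_iff)
  have one: "(\<lambda>_. 1) = torus_char (0 :: int ^ 'n)" by auto
  have "partial i (\<lambda>_. 1) = (\<lambda>_ :: real ^ 'n. 0)"
    by (rule ext, rule partial_eqI) simp
  moreover have "char_pairing \<eta> (\<lambda>_. 0) = 0"
    using char_pairing_cmult[of \<eta> 0 "\<lambda>_. 0"] by simp
  ultimately show ?thesis
    using char_pairing_partial[OF torus_char_smooth[of 0], of \<eta> i] i False by (simp flip: one)
qed

lemma char_pairing_torus_char:
  fixes \<eta> :: "int ^ 'n::finite"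
  shows "char_pairing \<eta> (torus_char (- \<zeta>)) = (if \<zeta> = \<eta> then complex_of_real ((2 * pi) ^ CARD('n)) else 0)"
proof -
  have "char_pairing \<eta> (torus_char (- \<zeta>)) = char_pairing (\<eta> - \<zeta>) (\<lambda>_. 1)"
    using torus_char_add[of \<eta> "- \<zeta>"] by (simp add: char_pairing_def)
  then show ?thesis by (simp add: char_pairing_one eq_commute[of \<zeta>])
qed

text \<open>The M-test makes the finite partial sums converge uniformly on the box, so integration
  can be done term by term.\<close>

lemma fourier_sum_pairing:
  fixes c :: "int ^ 'n::finite \<Rightarrow> complex"
  assumes c: "rapid c" and \<phi>: "continuous_on UNIV \<phi>" "\<And>y. norm (\<phi> y) \<le> B"
  shows "((\<lambda>\<eta>. c \<eta> * char_pairing \<eta> \<phi>) has_sum torus_integral (\<lambda>y. fourier_sum c y * \<phi> y)) UNIV"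
proof -
  let ?f = "\<lambda>\<eta> y. c \<eta> * (torus_char \<eta> y * \<phi> y)"
  have "uniform_limit (cbox 0 (\<chi> i. 2 * pi)) (\<lambda>X y. \<Sum>\<eta>\<in>X. ?f \<eta> y) (\<lambda>y. fourier_sum c y * \<phi> y)
      (finite_subsets_at_top UNIV)"
  proof (rule Weierstrass_m_test_general')
    show "norm (?f \<eta> y) \<le> norm (c \<eta>) * B" for \<eta> y
      using \<phi>(2) by (simp add: norm_mult mult_left_mono)
    show "((\<lambda>\<eta>. ?f \<eta> y) has_sum fourier_sum c y * \<phi> y) UNIV" for y
      using has_sum_cmult_left[OF has_sum_fourier_sum[OF c, of y], of "\<phi> y"] by (simp add: mult.assoc)
    show "(\<lambda>\<eta>. norm (c \<eta>) * B) summable_on UNIV"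
      by (intro summable_on_cmult_left rapid_summable_0 c)
  qed
  then obtain I J where I: "\<And>X. ((\<lambda>y. \<Sum>\<eta>\<in>X. ?f \<eta> y) has_integral I X) (cbox 0 (\<chi> i. 2 * pi))"
    and J: "((\<lambda>y. fourier_sum c y * \<phi> y) has_integral J) (cbox 0 (\<chi> i. 2 * pi))"
    and lim: "(I \<longlongrightarrow> J) (finite_subsets_at_top UNIV)"
  proof (rule uniform_limit_integral_cbox)
    show "continuous_on (cbox 0 (\<chi> i. 2 * pi)) (\<lambda>y. \<Sum>\<eta>\<in>X. ?f \<eta> y)" for X
      by (intro continuous_intros continuous_on_subset[OF \<phi>(1)]) auto
  qed auto
  have "I X = (\<Sum>\<eta>\<in>X. c \<eta> * char_pairing \<eta> \<phi>)" if "finite X" for X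
  proof -
    have "I X = torus_integral (\<lambda>y. \<Sum>\<eta>\<in>X. ?f \<eta> y)"
      using integral_unique[OF I[of X]] by (simp add: torus_integral_def)
    also have "\<dots> = (\<Sum>\<eta>\<in>X. torus_integral (?f \<eta>))"
      by (intro torus_integral_sum that continuous_intros \<phi>)
    finally show ?thesis by (simp add: torus_integral_cmult char_pairing_def)
  qed
  moreover have "J = torus_integral (\<lambda>y. fourier_sum c y * \<phi> y)"
    using integral_unique[OF J] by (simp add: torus_integral_def)
  ultimately show ?thesis
    unfolding has_sum_def using lim
    by (subst tendsto_cong[where g = I]) (auto intro: eventually_finite_subsets_at_top_weakI)
qed

section \<open>Uniqueness and inversion\<close>

lemma continuous_on_greater_near:
  fixes f :: "'a::metric_space \<Rightarrow> real"
  assumes "continuous_on K f" "x \<in> K" "l < f x"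
  shows "\<exists>d>0. \<forall>y\<in>K. dist y x < d \<longrightarrow> l < f y"
proof -
  have "0 < f x - l" using assms by simp
  then obtain d where d: "d > 0" "\<forall>y\<in>K. dist y x < d \<longrightarrow> dist (f y) (f x) < f x - l"
    using assms(1,2) unfolding continuous_on_iff by meson
  have "l < f y" if "y \<in> K" "dist y x < d" for y
    using d(2) that by (force simp: dist_real_def)
  with d(1) show ?thesis by blast
qed

text \<open>The powers of a function with a strict maximum at \<open>x\<close> concentrate at \<open>x\<close>: they decay at rate
  \<open>r\<close> away from \<open>x\<close>, but at most at a rate \<open>s > r\<close> on a small box.\<close>

lemma peak_kernel_zero:
  fixes g :: "'a::euclidean_space \<Rightarrow> complex" and Q :: "'a \<Rightarrow> real"
  assumes g: "continuous_on (cbox a b) g" and Q: "continuous_on (cbox a b) Q"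
    and x: "x \<in> box a b" "Q x = 1"
    and peak: "\<And>y. y \<in> cbox a b \<Longrightarrow> y \<noteq> x \<Longrightarrow> 0 \<le> Q y \<and> Q y < 1"
    and zero: "\<And>k. integral (cbox a b) (\<lambda>y. complex_of_real (Q y ^ k) * g y) = 0"
  shows "g x = 0"
proof (rule ccontr)
  assume gx: "g x \<noteq> 0"
  let ?K = "cbox a b"
  \<comment> \<open>Reduces to a real function with value 1 at \<open>x\<close>; its integrals
    against the powers of \<open>Q\<close> still vanish.\<close>
  define h where "h y = Re (g y / g x)" for y
  have xK: "x \<in> ?K" using x(1) box_subset_cbox by blast
  have h: "continuous_on ?K h" unfolding h_def by (intro continuous_intros g) (use gx in simp)
  have hx: "h x = 1" using gx by (simp add: h_def)
  have Q01: "0 \<le> Q y" if "y \<in> ?K" for y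
    using peak[OF that] x(2) by (cases "y = x") auto
  have hzero: "((\<lambda>y. Q y ^ k * h y) has_integral 0) ?K" for k
  proof -
    have "(\<lambda>y. complex_of_real (Q y ^ k) * g y) integrable_on ?K"
      by (intro integrable_continuous continuous_intros g Q)
    then have "((\<lambda>y. complex_of_real (Q y ^ k) * g y) has_integral 0) ?K"
      using zero[of k] by (simp add: has_integral_iff)
    from has_integral_linear[OF has_integral_mult_left[OF this, of "inverse (g x)"] bounded_linear_Re]
    show ?thesis
      by (simp add: comp_def h_def divide_inverse mult.assoc)
  qed
  obtain M where M: "\<And>y. y \<in> ?K \<Longrightarrow> \<bar>h y\<bar> \<le> M"
    using compact_imp_bounded[OF compact_continuous_image[OF h compact_cbox]]
    by (auto simp: bounded_iff)
  have M1: "1 \<le> M" using M[OF xK] hx by simp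
  obtain \<delta> where \<delta>: "\<delta> > 0" "\<And>y. y \<in> ?K \<Longrightarrow> dist y x < \<delta> \<Longrightarrow> h y > 1/2"
    using continuous_on_greater_near[OF h xK, of "1/2"] hx by auto
  obtain r where r: "0 \<le> r" "r < 1" "\<And>y. y \<in> ?K \<Longrightarrow> \<delta> \<le> dist y x \<Longrightarrow> Q y \<le> r"
  proof (cases "?K - ball x \<delta> = {}")
    case True
    then have "\<not> \<delta> \<le> dist y x" if "y \<in> ?K" for y using that by (force simp: dist_commute)
    then show ?thesis using that[of 0] by auto
  next
    case False
    have "compact (?K - ball x \<delta>)" by (intro compact_diff) auto
    then obtain z where z: "z \<in> ?K - ball x \<delta>" "\<And>y. y \<in> ?K - ball x \<delta> \<Longrightarrow> Q y \<le> Q z"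
      using continuous_attains_sup[OF _ False, of Q] continuous_on_subset[OF Q, of "?K - ball x \<delta>"] by blast
    then have "z \<noteq> x" using \<delta>(1) by auto
    then show ?thesis
      using that[of "Q z"] peak[of z] z by (auto simp: dist_commute)
  qed
  \<comment> \<open>Strictly between \<open>r\<close> and the peak value 1: \<open>Q\<close> exceeds
    \<open>s\<close> near \<open>x\<close> by continuity, and the ratio \<open>r / s\<close> is
    below 1.\<close>
  define s where "s = (1 + r) / 2"
  have s: "r < s" "s < 1" "0 < s" using r by (auto simp: s_def)
  obtain \<epsilon> where \<epsilon>: "\<epsilon> > 0" "\<And>y. y \<in> ?K \<Longrightarrow> dist y x < \<epsilon> \<Longrightarrow> Q y > s"
    using continuous_on_greater_near[OF Q xK, of s] x(2) s by auto
  have "open (box a b \<inter> ball x (min \<delta> \<epsilon>))" "x \<in> box a b \<inter> ball x (min \<delta> \<epsilon>)"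
    using x \<delta> \<epsilon> by auto
  then obtain c d where cd: "cbox c d \<subseteq> box a b \<inter> ball x (min \<delta> \<epsilon>)" "x \<in> box c d"
    by (rule open_contains_cbox)
  define v where "v = measure lborel (cbox c d)"
  define V where "V = measure lborel ?K"
  have v: "v > 0"
    using cd(2) unfolding v_def by (intro content_pos_lt) (metis less_trans mem_box(1))
  have sub: "cbox c d \<subseteq> ?K" using cd(1) box_subset_cbox[of a b] by blast
  have bound: "v \<le> 2 * M * V * (r / s) ^ k" for k
  proof -
    \<comment> \<open>A minorant of \<open>Q y ^ k * h y\<close>: the first term is earned on the
      small box, where \<open>h > 1/2\<close> and \<open>Q > s\<close>; the subtracted constant
      covers the points far from \<open>x\<close>, the only ones where \<open>h\<close> may be
      negative.\<close>
    have "((\<lambda>y. (if y \<in> cbox c d then s ^ k / 2 else 0) - M * r ^ k) has_integral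
        (v *\<^sub>R (s ^ k / 2) - V *\<^sub>R (M * r ^ k))) ?K"
      unfolding v_def V_def
      by (intro Henstock_Kurzweil_Integration.has_integral_diff has_integral_const)
        (simp only: has_integral_restrict[OF sub] has_integral_const)
    then have "v *\<^sub>R (s ^ k / 2) - V *\<^sub>R (M * r ^ k) \<le> 0"
    proof (rule has_integral_le[OF _ hzero[of k]])
      fix y assume y: "y \<in> ?K"
      show "(if y \<in> cbox c d then s ^ k / 2 else 0) - M * r ^ k \<le> Q y ^ k * h y"
      proof (cases "y \<in> cbox c d")
        case True
        then have d: "dist y x < \<delta>" "dist y x < \<epsilon>" using cd(1) by (auto simp: dist_commute)
        have "s ^ k * (1/2) \<le> Q y ^ k * h y"
          using s \<delta>(2)[OF y d(1)] \<epsilon>(2)[OF y d(2)] Q01[OF y]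
          by (intro mult_mono power_mono) auto
        moreover have "0 \<le> M * r ^ k" using M1 r by simp
        ultimately show ?thesis using True by simp
      next
        case False
        show ?thesis
        proof (cases "dist y x < \<delta>")
          case True
          have "0 \<le> Q y ^ k * h y" using \<delta>(2)[OF y True] Q01[OF y] by simp
          moreover have "0 \<le> M * r ^ k" using M1 r by simp
          ultimately show ?thesis using False by simp
        next
          case far: False
          have "\<bar>Q y ^ k * h y\<bar> \<le> r ^ k * M"
            unfolding abs_mult using r(3)[OF y] far Q01[OF y] M[OF y]
            by (intro mult_mono) (auto simp: power_abs intro!: power_mono)
          then show ?thesis using False by (simp add: abs_le_iff mult.commute)
        qed
      qed
    qed
    then show ?thesis using s by (simp add: field_simps power_divide)
  qed
  have "(\<lambda>k. 2 * M * V * (r / s) ^ k) \<longlonglongrightarrow> 2 * M * V * 0"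
    using r s by (intro tendsto_intros LIMSEQ_power_zero) simp
  then have "v \<le> 2 * M * V * 0"
    by (rule LIMSEQ_le_const) (use bound in blast)
  then show False using v by simp
qed

text \<open>Demanding zero at all frequencies, not just for the integral, makes the property stable
  under multiplication of \<open>p\<close> by trigonometric polynomials.\<close>

definition annihilated :: "(real ^ 'n::finite \<Rightarrow> complex) \<Rightarrow> (real ^ 'n \<Rightarrow> complex) \<Rightarrow> bool" where
  "annihilated g p \<longleftrightarrow> continuous_on UNIV p \<and> (\<forall>\<eta>. char_pairing \<eta> (\<lambda>y. p y * g y) = 0)"

text \<open>The factor is a combination of three characters, and multiplication by a character only
  shifts the frequency in the pairing.\<close>

lemma annihilated_mult_cos:
  fixes g :: "real ^ 'n::finite \<Rightarrow> complex"
  assumes g: "continuous_on UNIV g" and p: "annihilated g p"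
  shows "annihilated g (\<lambda>y. complex_of_real ((1 + cos (vec_nth y i - t)) / 2) * p y)"
  unfolding annihilated_def
proof (intro conjI allI)
  have pc: "continuous_on UNIV p" using p by (simp add: annihilated_def)
  show "continuous_on UNIV (\<lambda>y. complex_of_real ((1 + cos (vec_nth y i - t)) / 2) * p y)"
    by (intro continuous_intros pc) simp
  fix \<eta> :: "int ^ 'n"
  let ?e = "axis i 1 :: int ^ 'n"
  let ?w = "exp (\<i> * complex_of_real t)"
  have char: "torus_char ?e y = exp (\<i> * complex_of_real (vec_nth y i))" for y
    by (simp add: torus_char_def inner_freq axis_def if_distrib if_distribR cong: if_cong)
  have char': "torus_char (- ?e) y = exp (- (\<i> * complex_of_real (vec_nth y i)))" for y
    by (simp add: torus_char_def inner_freq axis_def if_distrib if_distribR sum_negf cong: if_cong)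
  have cos: "complex_of_real ((1 + cos (vec_nth y i - t)) / 2)
      = 1/2 + inverse ?w / 4 * torus_char ?e y + ?w / 4 * torus_char (- ?e) y" for y
    unfolding char char'
    by (simp add: cos_of_real[symmetric] cos_exp_eq exp_diff exp_minus divide_simps algebra_simps)
  have shift: "char_pairing \<eta> (\<lambda>y. torus_char \<zeta> y * (p y * g y)) = 0" for \<zeta>
  proof -
    have "char_pairing \<eta> (\<lambda>y. torus_char \<zeta> y * (p y * g y)) = char_pairing (\<eta> + \<zeta>) (\<lambda>y. p y * g y)"
      by (simp add: char_pairing_def torus_char_add mult.assoc)
    then show ?thesis using p by (simp add: annihilated_def)
  qed
  have cont0: "continuous_on UNIV (\<lambda>y. a * (p y * g y))" for a
    by (intro continuous_intros pc g)
  have cont: "continuous_on UNIV (\<lambda>y. a * (torus_char \<zeta> y * (p y * g y)))" for a \<zeta>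
    by (intro continuous_intros pc g)
  have "char_pairing \<eta> (\<lambda>y. complex_of_real ((1 + cos (vec_nth y i - t)) / 2) * p y * g y)
      = char_pairing \<eta> (\<lambda>y. (1/2 * (p y * g y) + inverse ?w / 4 * (torus_char ?e y * (p y * g y)))
          + ?w / 4 * (torus_char (- ?e) y * (p y * g y)))"
    unfolding cos by (simp add: algebra_simps)
  also have "\<dots> = (1/2 * char_pairing \<eta> (\<lambda>y. p y * g y)
      + inverse ?w / 4 * char_pairing \<eta> (\<lambda>y. torus_char ?e y * (p y * g y)))
      + ?w / 4 * char_pairing \<eta> (\<lambda>y. torus_char (- ?e) y * (p y * g y))"
    by (simp only: char_pairing_add[OF continuous_on_add[OF cont0 cont] cont] char_pairing_add[OF cont0 cont] char_pairing_cmult)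
  also have "\<dots> = 0"
    using p by (simp add: shift annihilated_def)
  finally show "char_pairing \<eta> (\<lambda>y. complex_of_real ((1 + cos (vec_nth y i - t)) / 2) * p y * g y) = 0" .
qed

lemma annihilated_mult_prod:
  fixes g :: "real ^ 'n::finite \<Rightarrow> complex"
  assumes g: "continuous_on UNIV g" and "finite I" and p: "annihilated g p"
  shows "annihilated g (\<lambda>y. complex_of_real (\<Prod>i\<in>I. (1 + cos (vec_nth y i - vec_nth x i)) / 2) * p y)"
  using assms(2)
proof (induction I rule: finite_induct)
  case (insert i I)
  then show ?case
    using annihilated_mult_cos[OF g insert.IH, of i "vec_nth x i"] by (simp add: mult.assoc)
qed (simp add: p)

lemma cos_less_one: "t \<noteq> 0 \<Longrightarrow> \<bar>t\<bar> < 2 * pi \<Longrightarrow> cos t < 1"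
  using cos_one_2pi_int[of t] order_le_imp_less_or_eq[OF cos_le_one[of t]]
  by (auto simp: abs_mult mult_less_cancel_right1)

text \<open>The kernel \<open>\<Prod>i. (1 + cos (y\<^sub>i - x\<^sub>i)) / 2\<close> is a trigonometric polynomial with its only peak in the
  box at \<open>x\<close>, provided that \<open>x\<close> is an interior point; the boundary is reached by continuity.\<close>

lemma fourier_uniqueness:
  fixes g :: "real ^ 'n::finite \<Rightarrow> complex"
  assumes g: "continuous_on UNIV g" and per: "\<And>i y. g (y + axis i (2 * pi)) = g y"
    and zero: "\<And>\<eta>. char_pairing \<eta> g = 0"
  shows "g y = 0"
proof -
  let ?b = "\<chi> i::'n. 2 * pi"
  have interior: "g x = 0" if x: "x \<in> box 0 ?b" for x
  proof -
    define q where "q y i = (1 + cos (vec_nth y i - vec_nth x i)) / 2" for y i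
    define Q where "Q y = (\<Prod>i\<in>UNIV. q y i)" for y
    have q01: "0 \<le> q y i" "q y i \<le> 1" for y i
      using cos_ge_minus_one[of "vec_nth y i - vec_nth x i"] cos_le_one[of "vec_nth y i - vec_nth x i"]
      unfolding q_def by (simp_all, linarith)
    have ann: "annihilated g (\<lambda>y. complex_of_real (Q y ^ k))" for k
    proof (induction k)
      case 0
      show ?case using zero by (simp add: annihilated_def)
    next
      case (Suc k)
      show ?case
        using annihilated_mult_prod[OF g finite_class.finite_UNIV Suc.IH, of x] by (simp add: Q_def q_def)
    qed
    show ?thesis
    proof (rule peak_kernel_zero[of 0 ?b g Q])
      show "continuous_on (cbox 0 ?b) g" using g continuous_on_subset by blast
      show "continuous_on (cbox 0 ?b) Q"
        unfolding Q_def q_def by (intro continuous_intros) simp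
      show "x \<in> box 0 ?b" by (rule x)
      show "Q x = 1" by (simp add: Q_def q_def)
    next
      fix y assume y: "y \<in> cbox 0 ?b" "y \<noteq> x"
      then obtain i where i: "vec_nth y i \<noteq> vec_nth x i"
        by (auto simp: Finite_Cartesian_Product.vec_eq_iff)
      have "\<bar>vec_nth y i - vec_nth x i\<bar> < 2 * pi"
        using y(1) x by (auto simp: mem_box_cart abs_less_iff dest!: spec[of _ i])
      then have "q y i < 1" using i cos_less_one[of "vec_nth y i - vec_nth x i"] by (simp add: q_def)
      \<comment> \<open>One coordinate in which \<open>y\<close> differs from \<open>x\<close>
        already gives a factor below 1; the other factors are at most 1.\<close>
      moreover have "Q y = q y i * (\<Prod>j\<in>UNIV - {i}. q y j)"
        unfolding Q_def by (rule prod.remove) auto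
      moreover have "q y i * (\<Prod>j\<in>UNIV - {i}. q y j) \<le> q y i * 1"
        by (intro mult_left_mono prod_le_1) (use q01 in auto)
      ultimately show "0 \<le> Q y \<and> Q y < 1"
        using q01 by (auto intro!: mult_nonneg_nonneg prod_nonneg)
    next
      fix k
      show "integral (cbox 0 ?b) (\<lambda>y. complex_of_real (Q y ^ k) * g y) = 0"
        using ann[of k] by (auto simp: annihilated_def char_pairing_def torus_integral_def dest!: spec[of _ 0])
    qed
  qed
  obtain z where z: "z \<in> cbox 0 ?b" "g y = g z"
    using periodic_box_representative[of g y, OF per] by blast
  have "box 0 ?b \<noteq> {}" by (simp add: interval_ne_empty_cart)
  then have "z \<in> closure (box 0 ?b)" using z(1) by (simp add: closure_box)
  moreover have "closed {x. g x = 0}"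
    using continuous_closed_preimage_constant[OF g] by simp
  then have "closure (box 0 ?b) \<subseteq> {x. g x = 0}"
    by (intro closure_minimal) (use interior in auto)
  ultimately show ?thesis using z(2) by auto
qed

text \<open>By orthogonality \<phi> and its Fourier series have the same pairings, so
  \<open>fourier_uniqueness\<close> applies to their difference.\<close>

lemma fourier_inversion:
  fixes \<phi> :: "real ^ 'n::finite \<Rightarrow> complex"
  assumes \<phi>: "\<phi> \<in> torus_smooth"
  defines "c \<equiv> \<lambda>\<eta>. inverse (complex_of_real ((2 * pi) ^ CARD('n))) * char_pairing (- \<eta>) \<phi>"
  shows "rapid c" "\<phi> = fourier_sum c"
proof -
  show c: "rapid c"
    unfolding c_def by (rule rapid_mult_slow[OF rapid_uminus_index[OF rapid_char_pairing[OF \<phi>]] slow_const])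
  \<comment> \<open>The difference is written with \<open>+\<close> and \<open>- 1 *\<close> to fit
    \<open>char_pairing_add\<close> and \<open>char_pairing_cmult\<close>.\<close>
  let ?\<psi> = "fourier_sum c" and ?g = "\<lambda>y. \<phi> y + - 1 * fourier_sum c y"
  note sm = \<phi> fourier_sum_smooth[OF c]
  note cont = sm[THEN torus_smooth_continuous]
  have "char_pairing \<zeta> ?\<psi> = char_pairing \<zeta> \<phi>" for \<zeta>
  proof -
    have "((\<lambda>\<eta>. c \<eta> * char_pairing \<eta> (torus_char \<zeta>)) has_sum torus_integral (\<lambda>y. ?\<psi> y * torus_char \<zeta> y)) UNIV"
      by (rule fourier_sum_pairing[OF c, of _ 1]) (simp_all add: continuous_on_torus_char)
    moreover have "((\<lambda>\<eta>. c \<eta> * char_pairing \<eta> (torus_char \<zeta>)) has_sum char_pairing \<zeta> \<phi>) UNIV"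
    proof (rule has_sum_finite_neutralI[of "{- \<zeta>}"])
      have "complex_of_real ((2 * pi) ^ CARD('n)) \<noteq> 0" by simp
      then show "char_pairing \<zeta> \<phi> = (\<Sum>\<eta>\<in>{- \<zeta>}. c \<eta> * char_pairing \<eta> (torus_char \<zeta>))"
        using char_pairing_torus_char[of "- \<zeta>" "- \<zeta>"]
        by (simp add: c_def del: of_real_power of_real_mult)
      show "c \<eta> * char_pairing \<eta> (torus_char \<zeta>) = 0" if "\<eta> \<in> UNIV - {- \<zeta>}" for \<eta>
        using char_pairing_torus_char[of \<eta> "- \<zeta>"] that by auto
    qed auto
    ultimately have "torus_integral (\<lambda>y. ?\<psi> y * torus_char \<zeta> y) = char_pairing \<zeta> \<phi>"
      by (rule has_sum_unique)
    then show ?thesis by (simp add: char_pairing_def mult.commute)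
  qed
  then have zero: "char_pairing \<zeta> ?g = 0" for \<zeta>
    by (simp only: char_pairing_add[OF cont(1) continuous_on_mult[OF continuous_on_const cont(2)]] char_pairing_cmult) simp
  have "?g y = 0" for y
  proof (rule fourier_uniqueness[where g = ?g])
    show "continuous_on UNIV ?g" by (intro continuous_intros cont)
    show "?g (y + axis i (2 * pi)) = ?g y" for i y by (simp add: sm[THEN torus_smoothD(1)])
  qed (rule zero)
  then show "\<phi> = fourier_sum c" by (auto simp: fun_eq_iff)
qed

section \<open>Fourier series of distributions\<close>

text \<open>The distribution with prescribed coefficients, inverse to \<open>fourier_coeff\<close>
  on slow families.\<close>

definition synthesis :: "(int ^ 'n::finite \<Rightarrow> complex) \<Rightarrow> 'n functional" where
  "synthesis c \<phi> = (\<Sum>\<^sub>\<infinity>\<eta>. c \<eta> * char_pairing \<eta> \<phi>)"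

lemma psdo_eq_synthesis: "psdo a u = synthesis (\<lambda>\<eta>. a \<eta> * fourier_coeff u \<eta>)"
  by (simp add: psdo_def synthesis_def char_pairing_def fun_eq_iff)

lemma has_sum_synthesis:
  assumes "slow c" "\<phi> \<in> torus_smooth"
  shows "((\<lambda>\<eta>. c \<eta> * char_pairing \<eta> \<phi>) has_sum synthesis c \<phi>) UNIV"
  unfolding synthesis_def
  by (rule has_sum_infsum, rule abs_summable_summable, rule rapid_summable_0, rule rapid_mult_slow)
    (use assms rapid_char_pairing in auto)

lemma synthesis_sum:
  assumes "finite I" "\<And>i. i \<in> I \<Longrightarrow> slow (c i)" "\<phi> \<in> torus_smooth"
  shows "(\<Sum>i\<in>I. synthesis (c i) \<phi>) = synthesis (\<lambda>\<eta>. \<Sum>i\<in>I. c i \<eta>) \<phi>"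
proof -
  have "((\<lambda>\<eta>. \<Sum>i\<in>I. c i \<eta> * char_pairing \<eta> \<phi>) has_sum (\<Sum>i\<in>I. synthesis (c i) \<phi>)) UNIV"
    by (intro has_sum_sum has_sum_synthesis assms)
  then show ?thesis
    unfolding synthesis_def[of "\<lambda>\<eta>. \<Sum>i\<in>I. c i \<eta>"] by (simp add: infsumI sum_distrib_right)
qed

text \<open>Growth of order \<open>k\<close> is compensated by \<open>k\<close> derivatives of the
  test function; \<open>2 * CARD('n)\<close> more make the series summable, which gives the order of
  the seminorm.\<close>

lemma synthesis_distribution:
  fixes c :: "int ^ 'n::finite \<Rightarrow> complex"
  assumes c: "slow c" shows "synthesis c \<in> torus_distribution"
  unfolding torus_distribution_def
proof (intro CollectI conjI ballI allI)
  fix \<phi> \<psi> :: "real ^ 'n \<Rightarrow> complex" assume sm: "\<phi> \<in> torus_smooth" "\<psi> \<in> torus_smooth"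
  note cont = sm[THEN torus_smooth_continuous]
  show "synthesis c (\<lambda>y. \<phi> y + \<psi> y) = synthesis c \<phi> + synthesis c \<psi>"
    unfolding synthesis_def[of c "\<lambda>y. \<phi> y + \<psi> y"]
    using has_sum_add[OF has_sum_synthesis[OF c sm(1)] has_sum_synthesis[OF c sm(2)]]
    by (intro infsumI) (simp add: char_pairing_add[OF cont] distrib_left)
next
  fix a and \<phi> :: "real ^ 'n \<Rightarrow> complex" assume sm: "\<phi> \<in> torus_smooth"
  show "synthesis c (\<lambda>y. a * \<phi> y) = a * synthesis c \<phi>"
    unfolding synthesis_def[of c "\<lambda>y. a * \<phi> y"]
    using has_sum_cmult_right[OF has_sum_synthesis[OF c sm], of a]
    by (intro infsumI) (simp add: char_pairing_cmult mult.left_commute)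
next
  let ?K = "2 * CARD('n)"
  let ?S = "\<Sum>\<^sub>\<infinity>\<eta> :: int ^ 'n. inverse (weight \<eta> ^ ?K)"
  obtain C k where C: "C \<ge> 0" "\<And>\<eta>. norm (c \<eta>) \<le> C * weight \<eta> ^ k"
    using slow_nonneg_const[OF c] by auto
  define D where "D = (1 + real CARD('n)) ^ (k + ?K) * (2 * pi) ^ CARD('n)"
  have "norm (synthesis c \<phi>) \<le> (C * D * ?S) * Ck_norm (k + ?K) \<phi>" if sm: "\<phi> \<in> torus_smooth" for \<phi>
  proof -
    have "norm (c \<eta> * char_pairing \<eta> \<phi>) \<le> (C * D * Ck_norm (k + ?K) \<phi>) * inverse (weight \<eta> ^ ?K)" for \<eta>
    proof -
      have "norm (c \<eta>) * norm (char_pairing \<eta> \<phi>) \<le> (C * weight \<eta> ^ k) * norm (char_pairing \<eta> \<phi>)"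
        by (intro mult_right_mono C) simp
      also have "\<dots> = C * (norm (char_pairing \<eta> \<phi>) * weight \<eta> ^ (k + ?K)) * inverse (weight \<eta> ^ ?K)"
        using weight_pos[of \<eta>] by (simp add: power_add field_simps)
      also have "\<dots> \<le> C * (D * Ck_norm (k + ?K) \<phi>) * inverse (weight \<eta> ^ ?K)"
        unfolding D_def by (intro mult_right_mono mult_left_mono char_pairing_decay sm C) simp
      finally show ?thesis by (simp add: norm_mult mult.assoc)
    qed
    then have "norm (synthesis c \<phi>) \<le> (C * D * Ck_norm (k + ?K) \<phi>) * ?S"
      by (rule norm_infsum_le[OF has_sum_synthesis[OF c sm]
            has_sum_cmult_right[OF has_sum_infsum[OF summable_inverse_weight]]])
    then show ?thesis by (simp add: mult_ac)
  qed
  then show "\<exists>C k. \<forall>\<phi>\<in>torus_smooth. norm (synthesis c \<phi>) \<le> C * Ck_norm k \<phi>" by blast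
qed

text \<open>No growth condition on \<open>c\<close> appears because orthogonality leaves at most one
  nonzero term.\<close>

lemma synthesis_torus_char:
  fixes c :: "int ^ 'n::finite \<Rightarrow> complex"
  shows "synthesis c (torus_char (- \<zeta>)) = c \<zeta> * complex_of_real ((2 * pi) ^ CARD('n))"
  unfolding synthesis_def
proof (rule infsumI, rule has_sum_finite_neutralI[of "{\<zeta>}"])
  show "c \<eta> * char_pairing \<eta> (torus_char (- \<zeta>)) = 0" if "\<eta> \<in> UNIV - {\<zeta>}" for \<eta>
    using char_pairing_torus_char[of \<eta> \<zeta>] that by auto
qed (auto simp: char_pairing_torus_char)

lemma fourier_coeff_synthesis: "fourier_coeff (synthesis c) = c"
  by (simp add: fourier_coeff_def synthesis_torus_char fun_eq_iff)

lemma torus_distributionD: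
  assumes "u \<in> torus_distribution"
  shows "\<phi> \<in> torus_smooth \<Longrightarrow> \<psi> \<in> torus_smooth \<Longrightarrow> u (\<lambda>y. \<phi> y + \<psi> y) = u \<phi> + u \<psi>"
    and "\<phi> \<in> torus_smooth \<Longrightarrow> u (\<lambda>y. c * \<phi> y) = c * u \<phi>"
    and "\<exists>C\<ge>0. \<exists>k. \<forall>\<phi>\<in>torus_smooth. norm (u \<phi>) \<le> C * Ck_norm k \<phi>"
proof -
  show "\<phi> \<in> torus_smooth \<Longrightarrow> \<psi> \<in> torus_smooth \<Longrightarrow> u (\<lambda>y. \<phi> y + \<psi> y) = u \<phi> + u \<psi>"
    "\<phi> \<in> torus_smooth \<Longrightarrow> u (\<lambda>y. c * \<phi> y) = c * u \<phi>"
    using assms by (simp_all add: torus_distribution_def)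
  have "\<exists>C k. \<forall>\<phi>\<in>torus_smooth. norm (u \<phi>) \<le> C * Ck_norm k \<phi>"
    using assms by (simp add: torus_distribution_def)
  then obtain C k where Ck: "\<And>\<phi>. \<phi> \<in> torus_smooth \<Longrightarrow> norm (u \<phi>) \<le> C * Ck_norm k \<phi>"
    by auto
  have "norm (u \<phi>) \<le> \<bar>C\<bar> * Ck_norm k \<phi>" if "\<phi> \<in> torus_smooth" for \<phi>
  proof -
    have "C * Ck_norm k \<phi> \<le> \<bar>C\<bar> * Ck_norm k \<phi>"
      by (intro mult_right_mono Ck_norm_nonneg that) simp
    then show ?thesis using Ck[OF that] by linarith
  qed
  then show "\<exists>C\<ge>0. \<exists>k. \<forall>\<phi>\<in>torus_smooth. norm (u \<phi>) \<le> C * Ck_norm k \<phi>"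
    by (intro exI[of _ "\<bar>C\<bar>"]) auto
qed

lemma fourier_sum_add:
  assumes "rapid c" "rapid d"
  shows "fourier_sum (\<lambda>\<eta>. c \<eta> + d \<eta>) = (\<lambda>y. fourier_sum c y + fourier_sum d y)"
proof
  fix y show "fourier_sum (\<lambda>\<eta>. c \<eta> + d \<eta>) y = fourier_sum c y + fourier_sum d y"
    unfolding fourier_sum_def[of "\<lambda>\<eta>. c \<eta> + d \<eta>"]
    using has_sum_add[OF has_sum_fourier_sum[OF assms(1)] has_sum_fourier_sum[OF assms(2)]]
    by (intro infsumI) (simp add: distrib_right)
qed

lemma rapid_restrict: "rapid c \<Longrightarrow> rapid (\<lambda>\<eta>. if \<eta> \<in> X then c \<eta> else 0)"
  using rapid_mult_slow[of c "\<lambda>\<eta>. if \<eta> \<in> X then 1 else 0"] slow_bounded[of "\<lambda>\<eta>. if \<eta> \<in> X then 1 else 0" 1]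
  by (simp add: if_distrib if_distribR cong: if_cong)

text \<open>Linearity handles finite partial sums, and continuity the tail, whose
  \<open>Ck_norm\<close> is bounded by the tail of a convergent series.\<close>

lemma distribution_fourier_sum:
  fixes u :: "'n::finite functional"
  assumes u: "u \<in> torus_distribution" and c: "rapid c"
  shows "((\<lambda>\<eta>. c \<eta> * u (torus_char \<eta>)) has_sum u (fourier_sum c)) UNIV"
proof -
  \<comment> \<open>Truncating coefficients keeps both the partial sum and the tail in the form
    \<open>fourier_sum\<close> of a rapid family.\<close>
  let ?r = "\<lambda>X \<eta>. if \<eta> \<in> X then c \<eta> else 0"
  have finite_part: "u (fourier_sum (?r X)) = (\<Sum>\<eta>\<in>X. c \<eta> * u (torus_char \<eta>))" if "finite X" for X
    using that
  proof (induction X rule: finite_induct)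
    case empty
    \<comment> \<open>Written as a multiple of a character so that homogeneity of \<open>u\<close>
      gives the value 0.\<close>
    have "fourier_sum (?r {}) = (\<lambda>y. 0 * torus_char 0 y)"
      by (simp add: fun_eq_iff fourier_sum_def)
    then show ?case using torus_distributionD(2)[OF u torus_char_smooth, of 0 0] by simp
  next
    case (insert \<zeta> X)
    have "?r (insert \<zeta> X) = (\<lambda>\<eta>. (if \<eta> = \<zeta> then c \<zeta> else 0) + ?r X \<eta>)"
      using insert.hyps by auto
    then have "fourier_sum (?r (insert \<zeta> X)) = (\<lambda>y. c \<zeta> * torus_char \<zeta> y + fourier_sum (?r X) y)"
      by (simp only: fourier_sum_add[OF rapid_single rapid_restrict[OF c]] fourier_sum_single)
    then have "u (fourier_sum (?r (insert \<zeta> X))) = u (\<lambda>y. c \<zeta> * torus_char \<zeta> y) + u (fourier_sum (?r X))"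
      using torus_distributionD(1)[OF u fourier_sum_smooth[OF rapid_single] fourier_sum_smooth[OF rapid_restrict[OF c]]]
      by (simp only: fourier_sum_single)
    then show ?case
      using insert by (simp add: torus_distributionD(2)[OF u torus_char_smooth])
  qed
  obtain C k where C: "C \<ge> 0" "\<And>\<phi>. \<phi> \<in> torus_smooth \<Longrightarrow> norm (u \<phi>) \<le> C * Ck_norm k \<phi>"
    using torus_distributionD(3)[OF u] by auto
  let ?f = "\<lambda>\<eta>. norm (c \<eta>) * weight \<eta> ^ k"
  have tail: "norm (u (fourier_sum c) - (\<Sum>\<eta>\<in>X. c \<eta> * u (torus_char \<eta>)))
      \<le> C * (infsum ?f UNIV - sum ?f X)" if X: "finite X" for X
  proof -
    have "c = (\<lambda>\<eta>. ?r X \<eta> + ?r (- X) \<eta>)" by auto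
    then have "fourier_sum c = (\<lambda>y. fourier_sum (?r X) y + fourier_sum (?r (- X)) y)"
      using fourier_sum_add[OF rapid_restrict[OF c] rapid_restrict[OF c], of X "- X"] by simp
    then have "u (fourier_sum c) - (\<Sum>\<eta>\<in>X. c \<eta> * u (torus_char \<eta>)) = u (fourier_sum (?r (- X)))"
      using torus_distributionD(1)[OF u fourier_sum_smooth[OF rapid_restrict[OF c]] fourier_sum_smooth[OF rapid_restrict[OF c]], of X "- X"]
      by (simp add: finite_part[OF X])
    also have "norm \<dots> \<le> C * Ck_norm k (fourier_sum (?r (- X)))"
      by (intro C fourier_sum_smooth rapid_restrict c)
    also have "\<dots> \<le> C * (\<Sum>\<^sub>\<infinity>\<eta>. norm (?r (- X) \<eta>) * weight \<eta> ^ k)"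
      by (intro mult_left_mono Ck_norm_fourier_sum_le rapid_restrict c C)
    also have "(\<Sum>\<^sub>\<infinity>\<eta>. norm (?r (- X) \<eta>) * weight \<eta> ^ k) = infsum ?f UNIV - sum ?f X"
    proof (rule infsumI)
      have "((\<lambda>\<eta>. if \<eta> \<in> X then ?f \<eta> else 0) has_sum sum ?f X) UNIV"
        by (rule has_sum_finite_neutralI[of X]) (use X in auto)
      from has_sum_diff[OF has_sum_infsum[OF rapid_summable[OF c, of k]] this]
      show "((\<lambda>\<eta>. norm (?r (- X) \<eta>) * weight \<eta> ^ k) has_sum infsum ?f UNIV - sum ?f X) UNIV"
        by (rule has_sum_cong[THEN iffD1, rotated]) auto
    qed
    finally show ?thesis .
  qed
  have "((\<lambda>X. C * (infsum ?f UNIV - sum ?f X)) \<longlongrightarrow> C * (infsum ?f UNIV - infsum ?f UNIV)) (finite_subsets_at_top UNIV)"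
    using has_sum_infsum[OF rapid_summable[OF c, of k]] unfolding has_sum_def
    by (intro tendsto_intros)
  then have "((\<lambda>X. C * (infsum ?f UNIV - sum ?f X)) \<longlongrightarrow> 0) (finite_subsets_at_top UNIV)" by simp
  then have "((\<lambda>X. u (fourier_sum c) - (\<Sum>\<eta>\<in>X. c \<eta> * u (torus_char \<eta>))) \<longlongrightarrow> 0) (finite_subsets_at_top UNIV)"
    by (rule Lim_null_comparison[rotated]) (auto intro!: eventually_finite_subsets_at_top_weakI tail)
  from tendsto_diff[OF tendsto_const[of "u (fourier_sum c)"] this] show ?thesis
    unfolding has_sum_def by simp
qed

lemma synthesis_fourier_coeff:
  fixes u :: "'n::finite functional"
  assumes u: "u \<in> torus_distribution" and \<phi>: "\<phi> \<in> torus_smooth"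
  shows "u \<phi> = synthesis (fourier_coeff u) \<phi>"
proof -
  let ?A = "complex_of_real ((2 * pi) ^ CARD('n))"
  have "((\<lambda>\<eta>. inverse ?A * char_pairing (- \<eta>) \<phi> * u (torus_char \<eta>)) has_sum u \<phi>) UNIV"
    using distribution_fourier_sum[OF u fourier_inversion(1)[OF \<phi>]] fourier_inversion(2)[OF \<phi>] by simp
  then have "((\<lambda>\<eta>. fourier_coeff u (- \<eta>) * char_pairing (- \<eta>) \<phi>) has_sum u \<phi>) UNIV"
    by (simp add: fourier_coeff_def divide_inverse mult_ac)
  \<comment> \<open>Reflecting the frequencies reconciles the sign in \<open>fourier_coeff\<close>
    with that in the inversion formula.\<close>
  moreover have "bij (uminus :: int ^ 'n \<Rightarrow> int ^ 'n)" by (rule bij_uminus)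
  ultimately have "((\<lambda>\<eta>. fourier_coeff u \<eta> * char_pairing \<eta> \<phi>) has_sum u \<phi>) UNIV"
    using has_sum_reindex_bij_betw[of uminus UNIV UNIV "\<lambda>\<eta>. fourier_coeff u \<eta> * char_pairing \<eta> \<phi>" "u \<phi>"] by simp
  then show ?thesis by (simp add: synthesis_def infsumI)
qed

text \<open>Agreement is asked on test functions only, since a functional is unconstrained
  elsewhere.\<close>

lemma synthesis_smooth:
  fixes u :: "'n::finite functional"
  assumes c: "rapid c" and u: "\<And>\<phi>. \<phi> \<in> torus_smooth \<Longrightarrow> u \<phi> = synthesis c \<phi>"
  shows "is_smooth_distribution u"
  unfolding is_smooth_distribution_def
proof (intro bexI ballI)
  show "fourier_sum c \<in> torus_smooth" by (rule fourier_sum_smooth[OF c])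
  fix \<phi> :: "real ^ 'n \<Rightarrow> complex" assume \<phi>: "\<phi> \<in> torus_smooth"
  obtain B where "\<And>y. norm (\<phi> y) \<le> B" using torus_smooth_bounded[OF \<phi>] by blast
  then show "u \<phi> = torus_integral (\<lambda>y. fourier_sum c y * \<phi> y)"
    unfolding u[OF \<phi>] synthesis_def
    by (intro infsumI fourier_sum_pairing[OF c torus_smooth_continuous[OF \<phi>]])
qed

lemma rapid_fourier_coeff:
  fixes u :: "'n::finite functional"
  assumes "is_smooth_distribution u" shows "rapid (fourier_coeff u)"
proof -
  obtain f where f: "f \<in> torus_smooth" "\<And>\<phi>. \<phi> \<in> torus_smooth \<Longrightarrow> u \<phi> = torus_integral (\<lambda>y. f y * \<phi> y)"
    using assms by (auto simp: is_smooth_distribution_def)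
  have "fourier_coeff u = (\<lambda>\<eta>. inverse (complex_of_real ((2 * pi) ^ CARD('n))) * char_pairing (- \<eta>) f)"
    by (simp add: fun_eq_iff fourier_coeff_def f(2)[OF torus_char_smooth] char_pairing_def divide_inverse mult.commute)
  then show ?thesis using fourier_inversion(1)[OF f(1)] by simp
qed

section \<open>Matrix symbols\<close>

lemma norm_freq_ge_1:
  fixes \<eta> :: "int ^ 'n::finite"
  assumes "\<eta> \<noteq> 0" shows "1 \<le> norm (freq \<eta>)"
proof -
  obtain i where "vec_nth \<eta> i \<noteq> 0"
    using assms by (auto simp: Finite_Cartesian_Product.vec_eq_iff)
  then have "1 \<le> \<bar>real_of_int (vec_nth \<eta> i)\<bar>" by linarith
  also have "\<dots> \<le> norm (freq \<eta>)" using component_le_norm_cart[of "freq \<eta>" i] by simp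
  finally show ?thesis .
qed

text \<open>The absolute value lets one natural exponent serve orders of either sign.\<close>

lemma powr_norm_freq_le:
  assumes "1 \<le> norm (freq \<eta>)" shows "norm (freq \<eta>) powr a \<le> weight \<eta> ^ nat \<lceil>\<bar>a\<bar>\<rceil>"
proof -
  have "norm (freq \<eta>) powr a \<le> norm (freq \<eta>) powr real (nat \<lceil>\<bar>a\<bar>\<rceil>)"
    by (rule powr_mono) (use assms in linarith)+
  also have "\<dots> = norm (freq \<eta>) ^ nat \<lceil>\<bar>a\<bar>\<rceil>"
    using assms by (intro powr_realpow) linarith
  also have "\<dots> \<le> weight \<eta> ^ nat \<lceil>\<bar>a\<bar>\<rceil>"
    by (intro power_mono norm_freq_le_weight) simp
  finally show ?thesis .
qed

lemma rapid_imp_slow: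
  assumes "rapid c" shows "slow c"
proof -
  obtain C where "\<And>\<eta>. norm (c \<eta>) * weight \<eta> ^ 0 \<le> C"
    using assms unfolding rapid_def by blast
  then show ?thesis by (intro slow_bounded[of c C]) simp
qed

text \<open>The exceptional part has finite support, so it is rapid and in particular slow.\<close>

lemma slow_if_cofinite_bound:
  assumes fin: "finite {\<eta>. \<not> norm (c \<eta>) \<le> C * weight \<eta> ^ k}" shows "slow c"
proof -
  let ?P = "\<lambda>\<eta>. norm (c \<eta>) \<le> C * weight \<eta> ^ k"
  have rap: "rapid (\<lambda>\<eta>. if ?P \<eta> then 0 else c \<eta>)"
    by (rule rapid_finite_support, rule finite_subset[OF _ fin]) auto
  have "slow (\<lambda>\<eta>. if ?P \<eta> then c \<eta> else 0)"
  proof -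
    have "norm (if ?P \<eta> then c \<eta> else 0) \<le> \<bar>C\<bar> * weight \<eta> ^ k" for \<eta>
    proof -
      have "C * weight \<eta> ^ k \<le> \<bar>C\<bar> * weight \<eta> ^ k" by (intro mult_right_mono) simp_all
      moreover have "0 \<le> \<bar>C\<bar> * weight \<eta> ^ k" by simp
      ultimately show ?thesis by auto
    qed
    then show ?thesis unfolding slow_def by blast
  qed
  then have "slow (\<lambda>\<eta>. (if ?P \<eta> then c \<eta> else 0) + (if ?P \<eta> then 0 else c \<eta>))"
    by (rule slow_add[OF _ rapid_imp_slow[OF rap]])
  also have "(\<lambda>\<eta>. (if ?P \<eta> then c \<eta> else 0) + (if ?P \<eta> then 0 else c \<eta>)) = c" by auto
  finally show ?thesis .
qed

text \<open>Frequency 0, where \<open>symbol_class\<close> imposes nothing, is the only possible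
  exception to the bound.\<close>

lemma slow_symbol_class:
  fixes a :: "int ^ 'n::finite \<Rightarrow> complex"
  assumes "a \<in> symbol_class \<nu>" shows "slow a"
proof -
  obtain C where C: "C > 0" "\<And>\<eta>. \<eta> \<noteq> 0 \<Longrightarrow> norm (a \<eta>) \<le> C * norm (freq \<eta>) powr \<nu>"
    using assms by (auto simp: symbol_class_def)
  have "norm (a \<eta>) \<le> C * weight \<eta> ^ nat \<lceil>\<bar>\<nu>\<bar>\<rceil>" if "\<eta> \<noteq> 0" for \<eta>
    using C(2)[OF that] mult_left_mono[OF powr_norm_freq_le[OF norm_freq_ge_1[OF that], of \<nu>], of C] C(1)
    by linarith
  then have "{\<eta>. \<not> norm (a \<eta>) \<le> C * weight \<eta> ^ nat \<lceil>\<bar>\<nu>\<bar>\<rceil>} \<subseteq> {0}" by auto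
  then show ?thesis by (intro slow_if_cofinite_bound) (rule finite_subset, auto)
qed

lemma slow_inverse:
  fixes c :: "int ^ 'n::finite \<Rightarrow> complex"
  assumes "C > 0" "R > 0" and le: "\<And>\<eta>. norm (freq \<eta>) \<ge> R \<Longrightarrow> norm (c \<eta>) \<ge> C * norm (freq \<eta>) powr (- M)"
  shows "slow (\<lambda>\<eta>. inverse (c \<eta>))"
proof (rule slow_if_cofinite_bound, rule finite_subset[OF _ finite_norm_freq_le[of R]], clarify)
  fix \<eta>
  assume not: "\<not> norm (inverse (c \<eta>)) \<le> inverse C * weight \<eta> ^ nat \<lceil>\<bar>M\<bar>\<rceil>"
  show "norm (freq \<eta>) \<le> R"
  proof (rule ccontr)
    assume far: "\<not> norm (freq \<eta>) \<le> R"
    \<comment> \<open>Positivity of \<open>R\<close> keeps the far frequencies away from 0, so their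
      norm is at least 1.\<close>
    then have "\<eta> \<noteq> 0" using assms(2) by auto
    then have 1: "1 \<le> norm (freq \<eta>)" by (rule norm_freq_ge_1)
    then have "0 < C * norm (freq \<eta>) powr (- M)" using assms(1) by (auto intro!: mult_pos_pos)
    then have "inverse (norm (c \<eta>)) \<le> inverse (C * norm (freq \<eta>) powr (- M))"
      using le[of \<eta>] far by (intro le_imp_inverse_le) auto
    also have "\<dots> = inverse C * norm (freq \<eta>) powr M"
      by (simp add: powr_minus)
    also have "\<dots> \<le> inverse C * weight \<eta> ^ nat \<lceil>\<bar>M\<bar>\<rceil>"
      using assms(1) by (intro mult_left_mono powr_norm_freq_le 1) simp
    finally show False using not by (simp add: norm_inverse)
  qed
qed

lemma slow_norm_le: "slow d \<Longrightarrow> (\<And>\<eta>. norm (c \<eta>) \<le> norm (d \<eta>)) \<Longrightarrow> slow c"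
  unfolding slow_def by (meson order_trans)

section \<open>Determinants, cofactors and eigenvectors\<close>

lemma slow_det:
  fixes B :: "int ^ 'n::finite \<Rightarrow> complex mat"
  assumes "\<And>\<eta>. B \<eta> \<in> carrier_mat m m"
    and "\<And>i j. i < m \<Longrightarrow> j < m \<Longrightarrow> slow (\<lambda>\<eta>. B \<eta> $$ (i, j))"
  shows "slow (\<lambda>\<eta>. Determinant.det (B \<eta>))"
  unfolding det_def'[OF assms(1)]
proof (intro slow_sum slow_mult slow_const slow_prod finite_permutations)
  fix p i assume "p \<in> {p. p permutes {0..<m}}" "i \<in> {0..<m}"
  then have "p i < m" using permutes_in_image[of p "{0..<m}" i] by auto
  then show "slow (\<lambda>\<eta>. B \<eta> $$ (i, p i))" using \<open>i \<in> {0..<m}\<close> by (intro assms(2)) auto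
qed auto

text \<open>An entry of the adjugate is a signed minor, and by the Leibniz formula a minor is a
  polynomial in slow entries.\<close>

lemma slow_adj_mat:
  fixes B :: "int ^ 'n::finite \<Rightarrow> complex mat"
  assumes B: "\<And>\<eta>. B \<eta> \<in> carrier_mat m m"
    and slow: "\<And>i j. i < m \<Longrightarrow> j < m \<Longrightarrow> slow (\<lambda>\<eta>. B \<eta> $$ (i, j))"
    and ij: "i < m" "j < m"
  shows "slow (\<lambda>\<eta>. adj_mat (B \<eta>) $$ (i, j))"
proof -
  have dims: "dim_row (B \<eta>) = m" "dim_col (B \<eta>) = m" for \<eta> using B[of \<eta>] by auto
  have "slow (\<lambda>\<eta>. Determinant.det (mat_delete (B \<eta>) j i))"
  proof (rule slow_det)
    show "mat_delete (B \<eta>) j i \<in> carrier_mat (m - 1) (m - 1)" for \<eta>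
      by (rule mat_delete_carrier[OF B])
    fix k l assume kl: "k < m - 1" "l < m - 1"
    then have "mat_delete (B \<eta>) j i $$ (k, l)
        = B \<eta> $$ (if k < j then k else Suc k, if l < i then l else Suc l)" for \<eta>
      by (simp add: mat_delete_def dims)
    then show "slow (\<lambda>\<eta>. mat_delete (B \<eta>) j i $$ (k, l))"
      using kl by (simp only:) (rule slow, auto)
  qed
  then have "slow (\<lambda>\<eta>. (- 1) ^ (j + i) * Determinant.det (mat_delete (B \<eta>) j i))"
    by (rule slow_mult[OF slow_const])
  then show ?thesis using ij by (simp add: adj_mat_def cofactor_def dims)
qed

text \<open>Entrywise form of \<open>adj_mat A * A = det A * 1\<close>. It avoids inverses, so it
  can be stated for singular \<open>A\<close> as well.\<close>

lemma cramer:
  fixes A :: "complex mat"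
  assumes A: "A \<in> carrier_mat m m" and i: "i < m"
  shows "Determinant.det A * x i = (\<Sum>j<m. adj_mat A $$ (i, j) * (\<Sum>k<m. A $$ (j, k) * x k))"
proof -
  note adj = adj_mat[OF A]
  have entry: "(\<Sum>j<m. adj_mat A $$ (i, j) * A $$ (j, k)) = (if k = i then Determinant.det A else 0)"
    if k: "k < m" for k
  proof -
    have "(adj_mat A * A) $$ (i, k) = (\<Sum>j<m. adj_mat A $$ (i, j) * A $$ (j, k))"
      using adj(1) A i k by (simp add: scalar_prod_def atLeast0LessThan)
    then show ?thesis using adj(3) i k by auto
  qed
  have "(\<Sum>j<m. adj_mat A $$ (i, j) * (\<Sum>k<m. A $$ (j, k) * x k))
      = (\<Sum>k<m. (\<Sum>j<m. adj_mat A $$ (i, j) * A $$ (j, k)) * x k)"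
    unfolding sum_distrib_left sum_distrib_right
    by (subst sum.swap) (simp add: mult.assoc)
  also have "\<dots> = (\<Sum>k<m. if k = i then Determinant.det A * x k else 0)"
    by (intro sum.cong) (auto simp: entry)
  also have "\<dots> = Determinant.det A * x i" using i by simp
  finally show ?thesis by simp
qed

text \<open>Evaluate the characteristic polynomial at 0; the signs disappear in the norm.\<close>

lemma norm_det_eq_prod_eigenvalues:
  fixes A :: "complex mat"
  assumes A: "A \<in> carrier_mat m m" and cp: "char_poly A = (\<Prod>j<m. [:- l j, 1:])"
  shows "norm (Determinant.det A) = (\<Prod>j<m. norm (l j))"
proof -
  have "- char_matrix A 0 = (- 1) \<cdot>\<^sub>m A"
    by (rule eq_matI) (use A in \<open>auto simp: char_matrix_def\<close>)
  then have "poly (char_poly A) 0 = (- 1) ^ m * Determinant.det A"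
    using char_poly_matrix[OF A, of 0] A by simp
  moreover have "poly (char_poly A) 0 = (\<Prod>j<m. - l j)" by (simp add: cp poly_prod)
  ultimately have "norm ((- 1) ^ m * Determinant.det A) = norm (\<Prod>j<m. - l j)" by simp
  then show ?thesis by (simp add: norm_mult norm_power prod_norm[symmetric])
qed

text \<open>With l1 norm 1 every component is bounded by 1, and summing upper bounds on the
  components gives an upper bound on 1; both facts are used for the counterexample.\<close>

lemma normalized_eigenvector:
  fixes A :: "complex mat"
  assumes A: "A \<in> carrier_mat m m" and "poly (char_poly A) e = 0"
  shows "\<exists>v. (\<Sum>k<m. norm (v k)) = 1 \<and> (\<forall>j<m. (\<Sum>k<m. A $$ (j, k) * v k) = e * v j)"
proof -
  obtain w where "eigenvector A w e"
    using assms eigenvalue_root_char_poly[OF A] by (auto simp: eigenvalue_def)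
  then have w: "w \<in> carrier_vec m" "w \<noteq> 0\<^sub>v m" "A *\<^sub>v w = e \<cdot>\<^sub>v w"
    using A by (auto simp: eigenvector_def)
  define S where "S = (\<Sum>k<m. norm (vec_index w k))"
  obtain i where i: "i < m" "vec_index w i \<noteq> 0"
    using w(1,2) by (metis carrier_vecD eq_vecI index_zero_vec)
  have "norm (vec_index w i) \<le> S"
    unfolding S_def using i by (intro member_le_sum) auto
  then have S: "S > 0" using i(2) by (metis less_le_trans zero_less_norm_iff)
  define v where "v k = vec_index w k / complex_of_real S" for k
  have "(\<Sum>k<m. norm (v k)) = 1"
    using S by (simp add: v_def norm_divide flip: sum_divide_distrib S_def)
  moreover have "(\<Sum>k<m. A $$ (j, k) * v k) = e * v j" if j: "j < m" for j
  proof -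
    have "vec_index (A *\<^sub>v w) j = (\<Sum>k<m. A $$ (j, k) * vec_index w k)"
      using A w(1) j by (simp add: scalar_prod_def atLeast0LessThan)
    moreover have "vec_index (A *\<^sub>v w) j = e * vec_index w j" using w(1) j by (simp add: w(3))
    ultimately show ?thesis by (simp add: v_def flip: sum_divide_distrib)
  qed
  ultimately show ?thesis by blast
qed

section \<open>Global hypoellipticity\<close>

text \<open>Testing against a character leaves at most one term of each series, so this holds for
  arbitrary functionals \<open>u k\<close>.\<close>

lemma fourier_coeff_psdo_system:
  fixes L :: "int ^ 'n::finite \<Rightarrow> complex mat"
  shows "fourier_coeff (psdo_system m L u j) \<eta> = (\<Sum>k<m. L \<eta> $$ (j, k) * fourier_coeff (u k) \<eta>)"
  unfolding psdo_system_def psdo_eq_synthesis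
  by (simp add: fourier_coeff_def[of "\<lambda>\<phi>. \<Sum>k<m. _ k \<phi>"] synthesis_torus_char sum_divide_distrib)

lemma hypoelliptic_if_eigenvalues_bounded_below:
  fixes L :: "int ^ 'n::finite \<Rightarrow> complex mat"
  assumes L: "\<And>\<eta>. L \<eta> \<in> carrier_mat m m"
    and slow: "\<And>j k. j < m \<Longrightarrow> k < m \<Longrightarrow> slow (\<lambda>\<eta>. L \<eta> $$ (j, k))"
    and cp: "\<And>\<eta>. char_poly (L \<eta>) = (\<Prod>j<m. [:- lam j \<eta>, 1:])"
    and bound: "\<And>j. j < m \<Longrightarrow> \<exists>C M R. C > 0 \<and> M > 0 \<and> R > 0 \<and>
            (\<forall>\<eta>. norm (freq \<eta>) \<ge> R \<longrightarrow> norm (lam j \<eta>) \<ge> C * norm (freq \<eta>) powr (- M))"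
  shows "globally_hypoelliptic m L"
  unfolding globally_hypoelliptic_def
proof (intro allI impI, elim conjE)
  fix u :: "nat \<Rightarrow> 'n functional" and i
  assume u: "\<forall>j<m. u j \<in> torus_distribution" and i: "i < m"
    and smooth: "\<forall>j<m. is_smooth_distribution (psdo_system m L u j)"
  let ?d = "\<lambda>\<eta>. Determinant.det (L \<eta>)"
  have nd: "norm (?d \<eta>) = (\<Prod>j<m. norm (lam j \<eta>))" for \<eta>
    by (rule norm_det_eq_prod_eigenvalues[OF L cp])
  have "slow (\<lambda>\<eta>. inverse (lam j \<eta>))" if "j < m" for j
    using bound[OF that] slow_inverse by blast
  then have "slow (\<lambda>\<eta>. \<Prod>j<m. inverse (lam j \<eta>))" by (intro slow_prod) auto
  then have slow_inv: "slow (\<lambda>\<eta>. inverse (?d \<eta>))"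
    by (rule slow_norm_le) (simp add: norm_inverse nd prod_norm[symmetric] prod_inversef[symmetric] comp_def)
  have "finite {\<eta>. lam j \<eta> = 0}" if j: "j < m" for j
  proof -
    obtain C M R where CMR: "C > 0" "R > 0"
      "\<And>\<eta>. norm (freq \<eta>) \<ge> R \<Longrightarrow> norm (lam j \<eta>) \<ge> C * norm (freq \<eta>) powr (- M)"
      using bound[OF j] by auto
    have "{\<eta>. lam j \<eta> = 0} \<subseteq> {\<eta>. norm (freq \<eta>) \<le> R}"
    proof clarify
      fix \<eta> assume z: "lam j \<eta> = 0"
      show "norm (freq \<eta>) \<le> R"
      proof (rule ccontr)
        assume "\<not> norm (freq \<eta>) \<le> R"
        then have "C * norm (freq \<eta>) powr (- M) \<le> 0" "norm (freq \<eta>) > 0"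
          using CMR(3)[of \<eta>] CMR(2) z by auto
        then show False using CMR(1) by (simp add: mult_le_0_iff)
      qed
    qed
    then show ?thesis using finite_norm_freq_le finite_subset by blast
  qed
  then have "finite (\<Union>j<m. {\<eta>. lam j \<eta> = 0})" by blast
  moreover have "{\<eta>. ?d \<eta> = 0} \<subseteq> (\<Union>j<m. {\<eta>. lam j \<eta> = 0})"
  proof clarify
    fix \<eta> assume "?d \<eta> = 0"
    then have "(\<Prod>j<m. norm (lam j \<eta>)) = 0" using nd[of \<eta>] by simp
    then show "\<eta> \<in> (\<Union>j<m. {\<eta>. lam j \<eta> = 0})" by auto
  qed
  ultimately have fin: "finite {\<eta>. ?d \<eta> = 0}" by (rule finite_subset[rotated])
  let ?f = "\<lambda>j \<eta>. \<Sum>k<m. L \<eta> $$ (j, k) * fourier_coeff (u k) \<eta>"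
  have "rapid (?f j)" if "j < m" for j
    using rapid_fourier_coeff[of "psdo_system m L u j"] smooth that
    by (simp add: fourier_coeff_psdo_system[abs_def])
  then have "rapid (\<lambda>\<eta>. adj_mat (L \<eta>) $$ (i, j) * ?f j \<eta>)" if "j < m" for j
    by (rule rapid_mult_slow) (use that in \<open>auto intro: slow_adj_mat[OF L slow] i\<close>)
  then have "rapid (\<lambda>\<eta>. \<Sum>j<m. adj_mat (L \<eta>) $$ (i, j) * ?f j \<eta>)"
    by (intro rapid_sum) auto
  then have "rapid (\<lambda>\<eta>. inverse (?d \<eta>) * (\<Sum>j<m. adj_mat (L \<eta>) $$ (i, j) * ?f j \<eta>))"
    by (rule rapid_mult_slow[OF _ slow_inv])
  \<comment> \<open>Cramer's rule says nothing where the determinant vanishes. There the inverse is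
    0 by convention, so the first summand drops out and the coefficient itself is restored by this
    finitely supported one.\<close>
  moreover have "rapid (\<lambda>\<eta>. if ?d \<eta> = 0 then fourier_coeff (u i) \<eta> else 0)"
    by (rule rapid_finite_support, rule finite_subset[OF _ fin]) auto
  ultimately have "rapid (\<lambda>\<eta>. inverse (?d \<eta>) * (\<Sum>j<m. adj_mat (L \<eta>) $$ (i, j) * ?f j \<eta>)
      + (if ?d \<eta> = 0 then fourier_coeff (u i) \<eta> else 0))"
    by (rule rapid_add)
  also have "(\<lambda>\<eta>. inverse (?d \<eta>) * (\<Sum>j<m. adj_mat (L \<eta>) $$ (i, j) * ?f j \<eta>)
      + (if ?d \<eta> = 0 then fourier_coeff (u i) \<eta> else 0)) = fourier_coeff (u i)"
    by (rule ext) (simp flip: cramer[OF L i])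
  finally show "is_smooth_distribution (u i)"
    using synthesis_fourier_coeff[of "u i"] u i by (intro synthesis_smooth[of "fourier_coeff (u i)"]) auto
qed

lemma rapid_on_fast_decay:
  fixes l :: "int ^ 'n::finite \<Rightarrow> complex" and e :: "nat \<Rightarrow> int ^ 'n"
  assumes e: "\<And>n. norm (freq (e n)) \<ge> real (Suc n)"
    and l: "\<And>n. norm (l (e n)) \<le> norm (freq (e n)) powr (- real (Suc n))"
  shows "rapid (\<lambda>\<eta>. if \<eta> \<in> range e then l \<eta> else 0)"
  unfolding rapid_def
proof
  fix k
  let ?g = "\<lambda>\<eta>. norm (l \<eta>) * weight \<eta> ^ k"
  \<comment> \<open>The sum covers the indices \<open>n < k\<close>, where the assumed decay may be
    too weak. For the others the decay beats the \<open>k\<close>-th power, and \<open>2 ^ k\<close>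
    comes from \<open>weight\<close> being at most twice a norm that is at least 1.\<close>
  let ?C = "(\<Sum>n<k. ?g (e n)) + 2 ^ k"
  have nonneg: "0 \<le> (\<Sum>n<k. ?g (e n))" by (intro sum_nonneg) simp
  have "?g (e n) \<le> ?C" for n
  proof (cases "n < k")
    case True
    then have "?g (e n) \<le> (\<Sum>n<k. ?g (e n))"
      by (intro member_le_sum[where f = "\<lambda>n. ?g (e n)"]) auto
    then show ?thesis by (smt (verit) zero_le_power)
  next
    case False
    let ?r = "norm (freq (e n))"
    have r: "1 \<le> ?r" "0 < ?r" using e[of n] by linarith+
    have "norm (l (e n)) \<le> ?r powr (- real k)"
      using l[of n] powr_mono[of "- real (Suc n)" "- real k" ?r] r False by simp
    also have "\<dots> = inverse (?r ^ k)" using r by (simp add: powr_minus powr_realpow)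
    finally have "?g (e n) \<le> inverse (?r ^ k) * (2 * ?r) ^ k"
      using r by (intro mult_mono power_mono) (auto simp: weight_def)
    also have "\<dots> = 2 ^ k" using r by (auto simp: power_mult_distrib)
    finally show ?thesis using nonneg by linarith
  qed
  moreover have "0 \<le> ?C" using nonneg by simp
  ultimately show "\<exists>C. \<forall>\<eta>. norm (if \<eta> \<in> range e then l \<eta> else 0) * weight \<eta> ^ k \<le> C"
    by (intro exI[of _ ?C]) auto
qed

lemma not_hypoelliptic_if_fast_decay:
  fixes L :: "int ^ 'n::finite \<Rightarrow> complex mat" and e :: "nat \<Rightarrow> int ^ 'n"
  assumes L: "\<And>\<eta>. L \<eta> \<in> carrier_mat m m"
    and slow: "\<And>j k. j < m \<Longrightarrow> k < m \<Longrightarrow> slow (\<lambda>\<eta>. L \<eta> $$ (j, k))"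
    and eigen: "\<And>\<eta>. poly (char_poly (L \<eta>)) (l \<eta>) = 0"
    and e: "\<And>n. norm (freq (e n)) \<ge> real (Suc n)"
    and l: "\<And>n. norm (l (e n)) \<le> norm (freq (e n)) powr (- real (Suc n))"
  shows "\<not> globally_hypoelliptic m L"
proof
  assume hyp: "globally_hypoelliptic m L"
  obtain v where v: "\<And>\<eta>. (\<Sum>k<m. norm (v \<eta> k)) = 1"
    "\<And>\<eta> j. j < m \<Longrightarrow> (\<Sum>k<m. L \<eta> $$ (j, k) * v \<eta> k) = l \<eta> * v \<eta> j"
    using normalized_eigenvector[OF L eigen] by metis
  \<comment> \<open>On \<open>range e\<close> the matrix acts on these coefficients as the tiny
    scalar \<open>l \<eta>\<close>; elsewhere there is nothing to act on.\<close>
  define c where "c k \<eta> = (if \<eta> \<in> range e then v \<eta> k else 0)" for k \<eta>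
  have c: "slow (c k)" if k: "k < m" for k
  proof (rule slow_bounded)
    fix \<eta>
    have "norm (v \<eta> k) \<le> (\<Sum>k<m. norm (v \<eta> k))" using k by (intro member_le_sum) auto
    then show "norm (c k \<eta>) \<le> 1" by (simp add: c_def v)
  qed
  have "is_smooth_distribution (psdo_system m L (\<lambda>k. synthesis (c k)) j)" if j: "j < m" for j
  proof (rule synthesis_smooth)
    show "rapid (\<lambda>\<eta>. c j \<eta> * (if \<eta> \<in> range e then l \<eta> else 0))"
      by (rule rapid_mult_slow[OF rapid_on_fast_decay[OF e l] c[OF j]])
    fix \<phi> :: "real ^ 'n \<Rightarrow> complex" assume \<phi>: "\<phi> \<in> torus_smooth"
    have "psdo_system m L (\<lambda>k. synthesis (c k)) j \<phi> = (\<Sum>k<m. synthesis (\<lambda>\<eta>. L \<eta> $$ (j, k) * c k \<eta>) \<phi>)"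
      by (simp add: psdo_system_def psdo_eq_synthesis fourier_coeff_synthesis)
    also have "\<dots> = synthesis (\<lambda>\<eta>. \<Sum>k<m. L \<eta> $$ (j, k) * c k \<eta>) \<phi>"
      by (intro synthesis_sum slow_mult slow c \<phi> j) auto
    also have "(\<lambda>\<eta>. \<Sum>k<m. L \<eta> $$ (j, k) * c k \<eta>) = (\<lambda>\<eta>. c j \<eta> * (if \<eta> \<in> range e then l \<eta> else 0))"
      by (rule ext) (simp add: c_def v(2)[OF j])
    finally show "psdo_system m L (\<lambda>k. synthesis (c k)) j \<phi>
        = synthesis (\<lambda>\<eta>. c j \<eta> * (if \<eta> \<in> range e then l \<eta> else 0)) \<phi>" .
  qed
  moreover have "\<forall>k<m. synthesis (c k) \<in> torus_distribution"
    using synthesis_distribution c by blast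
  ultimately have "\<forall>k<m. is_smooth_distribution (synthesis (c k))"
    using hyp[unfolded globally_hypoelliptic_def, THEN spec, of "\<lambda>k. synthesis (c k)"] by simp
  then have "rapid (c k)" if "k < m" for k
    using rapid_fourier_coeff[of "synthesis (c k)"] that by (simp add: fourier_coeff_synthesis)
  then have "\<forall>k\<in>{..<m}. \<exists>D. \<forall>\<eta>. norm (c k \<eta>) * weight \<eta> ^ 1 \<le> D"
    unfolding rapid_def by blast
  from bchoice[OF this] obtain D where D: "\<And>k \<eta>. k < m \<Longrightarrow> norm (c k \<eta>) * weight \<eta> \<le> D k"
    by auto
  have bounded: "weight (e n) \<le> (\<Sum>k<m. D k)" for n
  proof -
    \<comment> \<open>The l1 normalization replaces 1 by the sum of the component norms. Decay of
      first order in every component would then bound the weights, while the frequencies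
      \<open>e n\<close> are unbounded.\<close>
    have "weight (e n) = (\<Sum>k<m. norm (c k (e n))) * weight (e n)"
      by (simp add: c_def v)
    also have "\<dots> \<le> (\<Sum>k<m. D k)"
      unfolding sum_distrib_right by (intro sum_mono D) simp
    finally show ?thesis .
  qed
  define S where "S = (\<Sum>k<m. D k)"
  obtain n where "S < real n"
    using reals_Archimedean2 by blast
  moreover have "real (Suc n) \<le> S"
    using e[of n] norm_freq_le_weight[of "e n"] bounded[of n] unfolding S_def by linarith
  ultimately show False by simp
qed

theorem theorem2p1:
  fixes m :: nat and \<nu> :: real
    and L :: "int ^ 'n::finite \<Rightarrow> complex mat"
    and lam :: "nat \<Rightarrow> int ^ 'n \<Rightarrow> complex"
  assumes "m \<ge> 1"
    and "\<And>\<eta>. L \<eta> \<in> carrier_mat m m"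
    and "\<And>j k. j < m \<Longrightarrow> k < m \<Longrightarrow> (\<lambda>\<eta>. L \<eta> $$ (j, k)) \<in> symbol_class \<nu>"
    and "\<And>\<eta>. char_poly (L \<eta>) = (\<Prod>j<m. [:- lam j \<eta>, 1:])"
    and "\<And>\<eta> i j. i \<le> j \<Longrightarrow> j < m \<Longrightarrow> norm (lam i \<eta>) \<le> norm (lam j \<eta>)"
  shows "globally_hypoelliptic m L \<longleftrightarrow>
         (\<forall>j<m. \<exists>C M R. C > 0 \<and> M > 0 \<and> R > 0 \<and>
            (\<forall>\<eta>. norm (freq \<eta>) \<ge> R \<longrightarrow> norm (lam j \<eta>) \<ge> C * norm (freq \<eta>) powr (- M)))"
proof -
  note slow = slow_symbol_class[OF assms(3)]
  show ?thesis
  proof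
    assume hyp: "globally_hypoelliptic m L"
    show "\<forall>j<m. \<exists>C M R. C > 0 \<and> M > 0 \<and> R > 0 \<and>
        (\<forall>\<eta>. norm (freq \<eta>) \<ge> R \<longrightarrow> norm (lam j \<eta>) \<ge> C * norm (freq \<eta>) powr (- M))"
    proof (intro allI impI, rule ccontr)
      fix j assume j: "j < m"
      assume not: "\<not> (\<exists>C M R. C > 0 \<and> M > 0 \<and> R > 0 \<and>
        (\<forall>\<eta>. norm (freq \<eta>) \<ge> R \<longrightarrow> norm (lam j \<eta>) \<ge> C * norm (freq \<eta>) powr (- M)))"
      \<comment> \<open>Otherwise C = 1 and M = R = n + 1 would work for \<open>lam 0\<close>, hence
        by the ordering for \<open>lam j\<close>.\<close>
      have "\<exists>\<eta>. norm (freq \<eta>) \<ge> real (Suc n) \<and> norm (lam 0 \<eta>) \<le> norm (freq \<eta>) powr (- real (Suc n))" for n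
      proof (rule ccontr)
        assume none: "\<not> ?thesis"
        have "norm (lam j \<eta>) \<ge> 1 * norm (freq \<eta>) powr (- real (Suc n))"
          if "norm (freq \<eta>) \<ge> real (Suc n)" for \<eta>
          using none that assms(5)[OF le0 j, of \<eta>] by (smt (verit))
        then show False
          using not[unfolded not_ex, THEN spec, THEN spec, THEN spec, of 1 "real (Suc n)" "real (Suc n)"] by auto
      qed
      then obtain e where e: "\<And>n. norm (freq (e n)) \<ge> real (Suc n)"
        "\<And>n. norm (lam 0 (e n)) \<le> norm (freq (e n)) powr (- real (Suc n))"
        by metis
      \<comment> \<open>Since \<open>m\<close> is at least 1, index 0 contributes a factor of the
        product.\<close>
      have eigen: "poly (char_poly (L \<eta>)) (lam 0 \<eta>) = 0" for \<eta>
        unfolding assms(4) poly_prod by (rule prod_zero) (use assms(1) in auto)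
      show False
        using not_hypoelliptic_if_fast_decay[OF assms(2) slow eigen e] hyp by blast
    qed
  next
    assume "\<forall>j<m. \<exists>C M R. C > 0 \<and> M > 0 \<and> R > 0 \<and>
        (\<forall>\<eta>. norm (freq \<eta>) \<ge> R \<longrightarrow> norm (lam j \<eta>) \<ge> C * norm (freq \<eta>) powr (- M))"
    then show "globally_hypoelliptic m L"
      by (intro hypoelliptic_if_eigenvalues_bounded_below[OF assms(2) slow assms(4)]) auto
  qed
qed

end
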